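(* Let $\nu\in\mathbb{C}$ with $\mathrm{Re}(\nu)>-1$ and let $f\in S_{\nu}([0,\infty))$. Then $\mathcal{H}_{\nu}(\mathcal{H}_{\nu}(f))=f$.
   Context: $S([0,\infty))$ is the space of functions $f_1:[0,\infty)\to\mathbb{C}$ that are smooth on $[0,\infty)$ (one-sided at $0$) and such that $f_1$ and all its derivatives are rapidly decreasing at $\infty$. For $\mathrm{Re}(\nu)>-1$, $S_{\nu}([0,\infty))=\{f:[0,\infty)\to\mathbb{C} : f(x)=x^{1/2+\nu/2}f_1(x),\ f_1\in S([0,\infty))\}$ (so $f(0)=0$). For $x>0$, $J_{\nu}(x)=\sum_{k=0}^{\infty}\frac{(-1)^k(x/2)^{\nu+2k}}{\Gamma(k+1)\Gamma(k+\nu+1)}$. The Hankel transform of order $\nu$ is $\mathcal{H}_{\nu}(f)(y)=\int_{0}^{\infty}f(x)\sqrt{xy}\,J_{\nu}(2\sqrt{xy})\,\frac{dx}{x}$ for $y>0$, with value at $y=0$ given by continuity (it is $0$). The transform $\mathcal{H}_\nu$ maps $S_\nu([0,\infty))$ into itself, so the composition makes sense. *)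

theory Defs
  imports "HOL-Analysis.Analysis"
begin

text \<open>
  Functions on $[0,\infty)$ are represented by functions on all of \<open>real\<close>; only their values
  on \<open>{0..}\<close> matter. Derivatives are taken within \<open>{0..}\<close>, hence are one-sided at \<open>0\<close>.
\<close>

definition deriv_half_line :: "nat \<Rightarrow> (real \<Rightarrow> complex) \<Rightarrow> real \<Rightarrow> complex" where
  "deriv_half_line n = (\<lambda>g x. vector_derivative g (at x within {0..})) ^^ n"

definition smooth_half_line :: "(real \<Rightarrow> complex) \<Rightarrow> bool" where
  "smooth_half_line g \<longleftrightarrow>
     (\<forall>n. \<forall>x\<ge>0. deriv_half_line n g differentiable (at x within {0..}))"

definition schwartz_half_line :: "(real \<Rightarrow> complex) set" where
  "schwartz_half_line =
     {g. smooth_half_line g \<and>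
         (\<forall>n m. bounded ((\<lambda>x. of_real (x ^ m) * deriv_half_line n g x) ` {0..}))}"

text \<open>At \<open>x = 0\<close> the power below is \<open>0\<close>, so every member vanishes at \<open>0\<close>.\<close>

definition hankel_space :: "complex \<Rightarrow> (real \<Rightarrow> complex) set" where
  "hankel_space \<nu> =
     {f. \<exists>g\<in>schwartz_half_line. \<forall>x\<ge>0. f x = of_real x powr (1/2 + \<nu>/2) * g x}"

definition bessel_J :: "complex \<Rightarrow> real \<Rightarrow> complex" where
  "bessel_J \<nu> x =
     (\<Sum>k. (-1) ^ k * of_real (x/2) powr (\<nu> + 2 * of_nat k) /
           (Gamma (of_nat k + 1) * Gamma (of_nat k + \<nu> + 1)))"

text \<open>
  The value \<open>0\<close> at \<open>y = 0\<close> is the continuous extension for \<open>f \<in> hankel_space \<nu>\<close> with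
  \<open>Re \<nu> > -1\<close>; for such \<open>f\<close> the integral converges absolutely for every \<open>y > 0\<close>.
  The value at negative \<open>y\<close> is irrelevant.
\<close>

definition hankel :: "complex \<Rightarrow> (real \<Rightarrow> complex) \<Rightarrow> real \<Rightarrow> complex" where
  "hankel \<nu> f y =
     (if y > 0
      then (LINT x:{0<..}|lborel.
              f x * of_real (sqrt (x * y)) * bessel_J \<nu> (2 * sqrt (x * y)) / of_real x)
      else 0)"

end

theory Submission
  imports Defs
begin

text \<open>
  Let \<open>C\<close> be the entire function with \<open>J\<^sub>\<nu>(2 sqrt t) = t powr (\<nu>/2) * C(t)\<close>. Writing
  \<open>f x = x powr (1/2 + \<nu>/2) * g x\<close>, the Hankel transform becomes
  \<open>T g y = \<integral> x powr \<nu> * g x * C(x y) dx\<close>. This operator is symmetric for the weight \<open>x powr \<nu>\<close>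
  and maps \<open>exp (- s x)\<close> to \<open>s powr (- \<nu> - 1) * exp (- x / s)\<close>, hence \<open>T (T g)\<close> and \<open>g\<close> have the same
  weighted Laplace transform, and the uniqueness theorem for Laplace transforms gives
  \<open>T (T g) = g\<close>. Convergence rests on two facts: an energy estimate shows that \<open>C\<close> grows at most
  linearly on the half line, and \<open>T\<close> turns the operator \<open>x (d/dx)\<^sup>2 + (\<nu> + 1) d/dx\<close> into
  multiplication by \<open>- y\<close>, so that \<open>T g\<close> is again rapidly decreasing.
\<close>

subsection \<open>The Bessel-Clifford function\<close>

text \<open>Fubini does not apply to the double transform directly:
  \<open>y powr \<nu> * C(x y) * C(y z)\<close> is not absolutely integrable in \<open>y\<close>.
  Pairing with \<open>exp (- s x)\<close> supplies the missing decay. Symmetry then moves both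
  transforms onto the exponential, whose parameter goes from \<open>s\<close> to
  \<open>1 / s\<close> and back while the powers of \<open>s\<close> cancel. The growth bound on
  \<open>C\<close> can be crude, since rapid decay absorbs any polynomial factor. This matters for
  \<open>-1 < Re \<nu> < -1/2\<close>, where the energy need not decrease: the recurrence in the
  order passes to \<open>\<nu> + 1\<close> and \<open>\<nu> + 2\<close>, where it does, at the price
  of one factor \<open>t\<close>. Symmetry and Laplace uniqueness ask only for continuity and decay;
  the derivatives of \<open>g\<close> are spent on proving that decay.\<close>

definition bessel_clifford_coeff :: "complex \<Rightarrow> nat \<Rightarrow> complex" where
  "bessel_clifford_coeff \<nu> k = (-1) ^ k / fact k * rGamma (of_nat k + \<nu> + 1)"

text \<open>Up to the factor \<open>rGamma (\<nu> + 1)\<close> this is the hypergeometric series 0F1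
  with parameter \<open>\<nu> + 1\<close> at \<open>- z\<close>. Writing the coefficients with
  \<open>rGamma\<close> instead of a quotient by Gamma keeps the functional equation free of side
  conditions about poles.\<close>

definition bessel_clifford :: "complex \<Rightarrow> complex \<Rightarrow> complex" where
  "bessel_clifford \<nu> z = (\<Sum>k. bessel_clifford_coeff \<nu> k * z ^ k)"

lemma bessel_clifford_coeff_Suc:
  "of_nat (Suc k) * bessel_clifford_coeff \<nu> (Suc k) = - bessel_clifford_coeff (\<nu> + 1) k"
proof -
  have "of_nat (Suc k) + \<nu> + 1 = of_nat k + (\<nu> + 1) + 1" by simp
  thus ?thesis
    using of_nat_neq_0[of k, where 'a = complex]
    by (simp only: bessel_clifford_coeff_def fact_Suc power_Suc of_nat_mult)
       (simp del: of_nat_Suc)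
qed

text \<open>The functional equation of the reciprocal Gamma function; summed over \<open>k\<close>,
  it becomes the recurrence in the order.\<close>

lemma bessel_clifford_coeff_order:
  "(of_nat k + \<nu> + 1) * bessel_clifford_coeff (\<nu> + 1) k = bessel_clifford_coeff \<nu> k"
  using rGamma_plus1[of "of_nat k + \<nu> + 1"]
  by (simp add: bessel_clifford_coeff_def add_ac)

text \<open>The two coefficient identities combine to a two-term recursion within the order
  \<open>\<nu>\<close>. The modulus of \<open>k + \<nu> + 1\<close> is replaced by its real part so
  that the factor later matches the functional equation of the real Gamma function at
  \<open>k + Re \<nu> + 1\<close>.\<close>

lemma norm_bessel_clifford_coeff_Suc:
  assumes "Re \<nu> > -1"
  shows "(real k + Re \<nu> + 1) * real (Suc k) * norm (bessel_clifford_coeff \<nu> (Suc k))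
           \<le> norm (bessel_clifford_coeff \<nu> k)"
proof -
  have "(real k + Re \<nu> + 1) * (real (Suc k) * norm (bessel_clifford_coeff \<nu> (Suc k)))
        = (real k + Re \<nu> + 1) * norm (of_nat (Suc k) * bessel_clifford_coeff \<nu> (Suc k))"
    by (simp add: norm_mult del: of_nat_Suc)
  also have "\<dots> = (real k + Re \<nu> + 1) * norm (bessel_clifford_coeff (\<nu> + 1) k)"
    by (simp only: bessel_clifford_coeff_Suc norm_minus_cancel)
  also have "\<dots> \<le> norm (of_nat k + \<nu> + 1) * norm (bessel_clifford_coeff (\<nu> + 1) k)"
    using complex_Re_le_cmod[of "of_nat k + \<nu> + 1"] by (intro mult_right_mono) auto
  also have "\<dots> = norm (bessel_clifford_coeff \<nu> k)"
    by (metis bessel_clifford_coeff_order norm_mult)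
  finally show ?thesis by (simp add: mult_ac)
qed

lemma summable_norm_bessel_clifford:
  assumes "Re \<nu> > -1"
  shows "summable (\<lambda>k. norm (bessel_clifford_coeff \<nu> k * z ^ k))"
proof (rule summable_ratio_test[where c = "1/2" and N = "nat \<lceil>2 * norm z\<rceil> + 1"])
  fix n assume n: "nat \<lceil>2 * norm z\<rceil> + 1 \<le> n"
  define c where "c = norm (bessel_clifford_coeff \<nu> (Suc n))"
  have "2 * norm z \<le> real n" "1 \<le> real n" using n by linarith+
  hence "2 * norm z \<le> real n * real (Suc n)"
    by (smt (verit) mult_le_cancel_left1 of_nat_Suc)
  hence "2 * norm z * c \<le> real n * real (Suc n) * c"
    by (intro mult_right_mono) (auto simp: c_def)
  also have "\<dots> \<le> (real n + Re \<nu> + 1) * real (Suc n) * c"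
    using assms by (intro mult_right_mono) (auto simp: c_def)
  also have "\<dots> \<le> norm (bessel_clifford_coeff \<nu> n)"
    unfolding c_def by (rule norm_bessel_clifford_coeff_Suc[OF assms])
  finally have "2 * norm z * c * norm z ^ n \<le> norm (bessel_clifford_coeff \<nu> n) * norm z ^ n"
    by (rule mult_right_mono) auto
  thus "norm (norm (bessel_clifford_coeff \<nu> (Suc n) * z ^ Suc n))
          \<le> 1/2 * norm (norm (bessel_clifford_coeff \<nu> n * z ^ n))"
    by (simp add: norm_mult norm_power c_def mult_ac)
qed auto

lemma summable_bessel_clifford:
  "Re \<nu> > -1 \<Longrightarrow> summable (\<lambda>k. bessel_clifford_coeff \<nu> k * z ^ k)"
  by (rule summable_norm_cancel) (rule summable_norm_bessel_clifford)

section \<open>Differentiation and the Bessel-Clifford equation\<close>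

lemma DERIV_bessel_clifford:
  assumes "Re \<nu> > -1"
  shows "(bessel_clifford \<nu> has_field_derivative - bessel_clifford (\<nu> + 1) z) (at z)"
proof -
  have "(bessel_clifford \<nu> has_field_derivative
          (\<Sum>k. diffs (bessel_clifford_coeff \<nu>) k * z ^ k)) (at z)"
    unfolding bessel_clifford_def[abs_def]
    by (rule termdiffs_strong_converges_everywhere) (rule summable_bessel_clifford[OF assms])
  also have "(\<Sum>k. diffs (bessel_clifford_coeff \<nu>) k * z ^ k)
             = (\<Sum>k. - (bessel_clifford_coeff (\<nu> + 1) k * z ^ k))"
    by (simp only: diffs_def bessel_clifford_coeff_Suc mult_minus_left)
  also have "\<dots> = - bessel_clifford (\<nu> + 1) z"
    unfolding bessel_clifford_def
    by (rule suminf_minus, rule summable_bessel_clifford) (use assms in simp)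
  finally show ?thesis .
qed

text \<open>Since differentiating raises the order by one and changes the sign, this is the equation
  \<open>z C'' + (\<nu> + 1) C' + C = 0\<close> without derivatives. Coefficientwise it is
  \<open>bessel_clifford_coeff_order\<close>.\<close>

lemma bessel_clifford_recurrence:
  assumes "Re \<nu> > -1"
  shows "bessel_clifford \<nu> z
           = (\<nu> + 1) * bessel_clifford (\<nu> + 1) z - z * bessel_clifford (\<nu> + 2) z"
proof -
  let ?c = bessel_clifford_coeff
  have s: "(\<lambda>k. ?c \<mu> k * z ^ k) sums bessel_clifford \<mu> z" if "Re \<mu> > -1" for \<mu>
    unfolding bessel_clifford_def using summable_bessel_clifford[OF that] by (rule summable_sums)
  have "(\<lambda>k. z * (- (?c (\<nu> + 2) k * z ^ k))) sums (z * (- bessel_clifford (\<nu> + 2) z))"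
    by (intro sums_mult sums_minus s) (use assms in simp)
  also have "(\<lambda>k. z * (- (?c (\<nu> + 2) k * z ^ k)))
             = (\<lambda>k. of_nat (Suc k) * ?c (\<nu> + 1) (Suc k) * z ^ Suc k)"
    by (simp only: bessel_clifford_coeff_Suc) (simp add: add_ac fun_eq_iff)
  \<comment> \<open>The term with \<open>k = 0\<close> carries the factor 0, so shifting the index
    adds nothing.\<close>
  finally have "(\<lambda>k. of_nat k * ?c (\<nu> + 1) k * z ^ k) sums (- z * bessel_clifford (\<nu> + 2) z)"
    by (subst (asm) sums_Suc_iff) simp
  from sums_add[OF this sums_mult[OF s[of "\<nu> + 1"], of "\<nu> + 1"]]
  have "(\<lambda>k. (of_nat k + \<nu> + 1) * ?c (\<nu> + 1) k * z ^ k) sums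
          (- z * bessel_clifford (\<nu> + 2) z + (\<nu> + 1) * bessel_clifford (\<nu> + 1) z)"
    using assms by (simp add: algebra_simps)
  hence "(\<lambda>k. ?c \<nu> k * z ^ k) sums
          (- z * bessel_clifford (\<nu> + 2) z + (\<nu> + 1) * bessel_clifford (\<nu> + 1) z)"
    by (simp only: bessel_clifford_coeff_order)
  from sums_unique2[OF s this] show ?thesis using assms by simp
qed

lemma continuous_on_bessel_clifford:
  "Re \<nu> > -1 \<Longrightarrow> continuous_on A (bessel_clifford \<nu>)"
  by (meson DERIV_bessel_clifford DERIV_isCont continuous_at_imp_continuous_on)

lemma bessel_clifford_vector_derivative:
  assumes "Re \<nu> > -1"
  shows "((\<lambda>t. bessel_clifford \<nu> (of_real (t * y))) has_vector_derivative
            - of_real y * bessel_clifford (\<nu> + 1) (of_real (t * y))) (at t within A)"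
proof -
  have "((\<lambda>t. of_real (t * y) :: complex) has_vector_derivative of_real y) (at t within A)"
    by (rule has_vector_derivative_of_real) (auto intro!: derivative_eq_intros)
  from field_vector_diff_chain_within[OF this, of "bessel_clifford \<nu>"
      "- bessel_clifford (\<nu> + 1) (of_real (t * y))"]
  show ?thesis
    using DERIV_subset[OF DERIV_bessel_clifford[OF assms]]
    by (simp add: o_def mult_ac)
qed

text \<open>
  The energy \<open>t |C'(t)|\<^sup>2 + |C(t)|\<^sup>2\<close> is nonincreasing along the Bessel-Clifford equation
  \<open>t C'' + (\<nu> + 1) C' + C = 0\<close> as soon as \<open>Re \<nu> \<ge> -1/2\<close>.
\<close>

lemma bessel_clifford_le_at_0:
  assumes "Re \<nu> \<ge> -1/2" "t \<ge> 0"
  shows "norm (bessel_clifford \<nu> (of_real t)) \<le> norm (bessel_clifford \<nu> 0)"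
proof -
  \<comment> \<open>Up to the sign \<open>(-1) ^ j\<close>, \<open>C j\<close> is the
    \<open>j\<close>-th derivative of \<open>C 0\<close>; the sign disappears in the energy
    \<open>E\<close>.\<close>
  define C where "C j t = bessel_clifford (\<nu> + of_nat j) (of_real t)" for j and t :: real
  define E where "E t = t * (C 1 t \<bullet> C 1 t) + C 0 t \<bullet> C 0 t" for t
  have dC: "(C j has_vector_derivative - C (Suc j) t) (at t)" for j t
    using bessel_clifford_vector_derivative[of "\<nu> + of_nat j" 1 t UNIV] assms
    by (simp add: C_def[abs_def] add_ac)
  have E': "(E has_real_derivative -(2 * Re \<nu> + 1) * (norm (C 1 t))\<^sup>2) (at t)" for t
  proof -
    have "(E has_vector_derivative
            (C 1 t \<bullet> C 1 t + t * (C 1 t \<bullet> (- C 2 t) + (- C 2 t) \<bullet> C 1 t)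
             + (C 0 t \<bullet> (- C 1 t) + (- C 1 t) \<bullet> C 0 t))) (at t)"
    proof -
      have inner: "((\<lambda>t. C j t \<bullet> C j t) has_vector_derivative
                     (C j t \<bullet> (- C (Suc j) t) + (- C (Suc j) t) \<bullet> C j t)) (at t)" for j
        by (rule bounded_bilinear.has_vector_derivative[OF bounded_bilinear_inner dC dC])
      have "((\<lambda>t. t * (C 1 t \<bullet> C 1 t)) has_vector_derivative
              (t * (C 1 t \<bullet> (- C 2 t) + (- C 2 t) \<bullet> C 1 t) + 1 * (C 1 t \<bullet> C 1 t))) (at t)"
        using inner[of 1] by (intro has_vector_derivative_mult has_vector_derivative_id)
          (simp add: numeral_2_eq_2)
      from has_vector_derivative_add[OF this inner[of 0]] show ?thesis
        by (simp add: E_def[abs_def] add_ac)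
    qed
    \<comment> \<open>Substituting this cancels the terms with \<open>C 2\<close>, and the real
      inner product of \<open>(\<nu> + 1) * C 1 t\<close> with \<open>C 1 t\<close> sees only
      \<open>Re \<nu> + 1\<close>. This is why complex orders cause no trouble.\<close>
    moreover have C0: "C 0 t = (\<nu> + 1) * C 1 t - of_real t * C 2 t"
      using bessel_clifford_recurrence[of \<nu> "of_real t"] assms by (simp add: C_def)
    have "C 1 t \<bullet> C 1 t + t * (C 1 t \<bullet> (- C 2 t) + (- C 2 t) \<bullet> C 1 t)
             + (C 0 t \<bullet> (- C 1 t) + (- C 1 t) \<bullet> C 0 t)
           = -(2 * Re \<nu> + 1) * (norm (C 1 t))\<^sup>2"
      unfolding C0 inner_complex_def cmod_power2 by (simp add: algebra_simps power2_eq_square)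
    ultimately show ?thesis by (simp add: has_real_derivative_iff_has_vector_derivative)
  qed
  have "E t \<le> E 0"
    by (rule DERIV_nonpos_imp_nonincreasing[OF assms(2)])
       (use E' assms in \<open>auto intro!: exI mult_nonpos_nonneg\<close>)
  hence "(norm (C 0 t))\<^sup>2 \<le> (norm (C 0 0))\<^sup>2"
    using assms(2) by (simp add: E_def power2_norm_eq_inner)
       (smt (verit) inner_ge_zero mult_nonneg_nonneg)
  thus ?thesis by (simp add: C_def power2_le_iff_abs_le)
qed

text \<open>The orders \<open>\<nu> + 1\<close> and \<open>\<nu> + 2\<close> have positive real
  part, so the energy estimate covers them; the factor \<open>t\<close> in the recurrence is the
  source of the linear growth.\<close>

lemma bessel_clifford_linear_bound:
  assumes "Re \<nu> > -1"
  obtains K where "K > 0" "\<And>t. t \<ge> 0 \<Longrightarrow> norm (bessel_clifford \<nu> (of_real t)) \<le> K * (1 + t)"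
proof
  define K where "K = 1 + norm (\<nu> + 1) * norm (bessel_clifford (\<nu> + 1) 0)
                        + norm (bessel_clifford (\<nu> + 2) 0)"
  show "K > 0" by (simp add: K_def add_pos_nonneg)
  fix t :: real assume t: "t \<ge> 0"
  have "norm (bessel_clifford \<nu> (of_real t))
     \<le> norm (\<nu> + 1) * norm (bessel_clifford (\<nu> + 1) (of_real t))
       + t * norm (bessel_clifford (\<nu> + 2) (of_real t))"
    using t by (subst bessel_clifford_recurrence[OF assms])
       (rule order_trans[OF norm_triangle_ineq4], simp add: norm_mult)
  also have "\<dots> \<le> norm (\<nu> + 1) * norm (bessel_clifford (\<nu> + 1) 0)
       + t * norm (bessel_clifford (\<nu> + 2) 0)"
    by (intro add_mono mult_left_mono bessel_clifford_le_at_0) (use assms t in auto)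
  also have "\<dots> \<le> K * (1 + t)"
    using t by (simp add: K_def algebra_simps)
  finally show "norm (bessel_clifford \<nu> (of_real t)) \<le> K * (1 + t)" .
qed

lemma bessel_J_eq_bessel_clifford:
  assumes "Re \<nu> > -1" "t > 0"
  shows "bessel_J \<nu> (2 * sqrt t) = of_real t powr (\<nu> / 2) * bessel_clifford \<nu> (of_real t)"
proof -
  have "(-1) ^ k * complex_of_real (sqrt t) powr (\<nu> + 2 * of_nat k) /
           (Gamma (of_nat k + 1) * Gamma (of_nat k + \<nu> + 1))
        = of_real t powr (\<nu> / 2) * (bessel_clifford_coeff \<nu> k * of_real t ^ k)" for k
  proof -
    have t: "complex_of_real (sqrt t) powr w = of_real t powr (w/2)" for w
      using assms by (simp add: powr_def Ln_of_real ln_sqrt)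
    have "complex_of_real (sqrt t) powr (\<nu> + 2 * of_nat k) = of_real t powr (\<nu> / 2) * of_real t ^ k"
      using assms by (simp add: t add_divide_distrib powr_add)
    thus ?thesis
      by (simp add: bessel_clifford_coeff_def Gamma_fact rGamma_inverse_Gamma field_simps
               flip: Gamma_fact)
  qed
  hence "bessel_J \<nu> (2 * sqrt t)
        = (\<Sum>k. of_real t powr (\<nu> / 2) * (bessel_clifford_coeff \<nu> k * of_real t ^ k))"
    by (simp add: bessel_J_def)
  also have "\<dots> = of_real t powr (\<nu> / 2) * bessel_clifford \<nu> (of_real t)"
    unfolding bessel_clifford_def by (rule suminf_mult[OF summable_bessel_clifford[OF assms(1)]])
  finally show ?thesis .
qed

subsection \<open>Rapidly decreasing functions on the half line\<close>

text \<open>A measure of its own instead of set integrals lets Fubini's theorem for sigma-finite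
  pairs apply as it stands. The point 0 is left out because the powers of \<open>x\<close> may be
  singular there.\<close>

abbreviation half_line :: "real measure" where
  "half_line \<equiv> restrict_space lborel {0<..}"

text \<open>No derivatives occur, since none of the transform are ever estimated. The case
  \<open>m = 0\<close> gives boundedness up to 0, which makes the weight \<open>x powr \<nu>\<close>
  with \<open>Re \<nu> > -1\<close> integrable there.\<close>

definition rapidly_decreasing :: "(real \<Rightarrow> complex) \<Rightarrow> bool" where
  "rapidly_decreasing h \<longleftrightarrow>
     continuous_on {0<..} h \<and> (\<forall>m. \<exists>B. \<forall>x>0. x ^ m * norm (h x) \<le> B)"

lemma integrable_half_line_iff:
  fixes f :: "real \<Rightarrow> 'a::{banach, second_countable_topology}"
  shows "integrable half_line f \<longleftrightarrow> set_integrable lborel {0<..} f"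
  unfolding set_integrable_def by (rule integrable_restrict_space) simp

lemma integral_half_line_eq:
  fixes f :: "real \<Rightarrow> 'a::{banach, second_countable_topology}"
  shows "integral\<^sup>L half_line f = (LINT x:{0<..}|lborel. f x)"
  unfolding set_lebesgue_integral_def by (rule integral_restrict_space) simp

lemma AE_half_lineI: "(\<And>x. x > 0 \<Longrightarrow> P x) \<Longrightarrow> AE x in half_line. P x"
  by (rule AE_I2) (simp add: space_restrict_space)

lemma integral_half_line_cong:
  "(\<And>x. x > 0 \<Longrightarrow> f x = g x) \<Longrightarrow> integral\<^sup>L half_line f = integral\<^sup>L half_line g"
  by (rule Bochner_Integration.integral_cong) (auto simp: space_restrict_space)

lemma measurable_half_lineI:
  fixes f :: "real \<Rightarrow> 'a::topological_space"
  assumes "continuous_on {0<..} f"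
  shows "f \<in> borel_measurable half_line"
proof -
  have "sets half_line = sets (restrict_space borel {0<..})"
    by (rule sets_restrict_space_cong) simp
  with borel_measurable_continuous_on_restrict[OF assms] show ?thesis
    using measurable_cong_sets[of half_line _ borel borel] by blast
qed

lemma continuous_on_of_real_powr:
  "continuous_on {0<..} (\<lambda>x. complex_of_real x powr z)"
  by (intro continuous_intros) (auto simp: complex_nonpos_Reals_iff)

interpretation half_line: sigma_finite_measure half_line
  by (rule sigma_finite_measure_restrict_space) (auto intro: sigma_finite_lborel)

interpretation half_line_pair: pair_sigma_finite half_line half_line ..

lemma rapidly_decreasing_bound:
  assumes "rapidly_decreasing h"
  obtains B where "B > 0" "\<And>x. x > 0 \<Longrightarrow> x ^ m * norm (h x) \<le> B"
proof -
  obtain B where "\<forall>x>0. x ^ m * norm (h x) \<le> B"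
    using assms unfolding rapidly_decreasing_def by blast
  thus ?thesis by (intro that[of "\<bar>B\<bar> + 1"]) force+
qed

text \<open>A factor of linear growth costs one extra power of \<open>x\<close>, paid by the decay
  bound for \<open>Suc m\<close>.\<close>

lemma rapidly_decreasing_mult:
  fixes c :: "real \<Rightarrow> complex"
  assumes h: "rapidly_decreasing h" and c: "continuous_on {0<..} c"
    and K: "\<And>x. x > 0 \<Longrightarrow> norm (c x) \<le> K * (1 + x)"
  shows "rapidly_decreasing (\<lambda>x. c x * h x)"
  unfolding rapidly_decreasing_def
proof (intro conjI allI)
  show "continuous_on {0<..} (\<lambda>x. c x * h x)"
    using h c by (auto simp: rapidly_decreasing_def intro!: continuous_intros)
  fix m
  obtain B where B: "B > 0" "\<And>x. x > 0 \<Longrightarrow> x ^ m * norm (h x) \<le> B"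
    using rapidly_decreasing_bound[OF h] by blast
  obtain B' where B': "B' > 0" "\<And>x. x > 0 \<Longrightarrow> x ^ Suc m * norm (h x) \<le> B'"
    using rapidly_decreasing_bound[OF h] by blast
  \<comment> \<open>The growth bound at \<open>x = 1\<close> forces \<open>K\<close> to be
    nonnegative.\<close>
  have "0 \<le> K * (1 + 1)" by (rule order_trans[OF norm_ge_zero K]) simp
  hence "K \<ge> 0" by simp
  show "\<exists>B. \<forall>x>0. x ^ m * norm (c x * h x) \<le> B"
  proof (intro exI allI impI)
    fix x :: real assume x: "x > 0"
    have "x ^ m * norm (c x * h x) = norm (c x) * (x ^ m * norm (h x))"
      by (simp add: norm_mult)
    also have "\<dots> \<le> K * (1 + x) * (x ^ m * norm (h x))"
      using x by (intro mult_right_mono K) auto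
    also have "\<dots> = K * (x ^ m * norm (h x) + x ^ Suc m * norm (h x))"
      by (simp add: algebra_simps)
    also have "\<dots> \<le> K * (B + B')"
      using \<open>K \<ge> 0\<close> x by (intro mult_left_mono add_mono B B') auto
    finally show "x ^ m * norm (c x * h x) \<le> K * (B + B')" .
  qed
qed

lemma rapidly_decreasing_mult_linear:
  assumes "rapidly_decreasing h"
  shows "rapidly_decreasing (\<lambda>x. (a + of_real x) * h x)"
proof (rule rapidly_decreasing_mult[OF assms])
  fix x :: real assume "x > 0"
  hence "norm (a + of_real x) \<le> norm a + x"
    by (metis norm_of_real norm_triangle_ineq abs_of_pos)
  also have "\<dots> \<le> (1 + norm a) * (1 + x)" using \<open>x > 0\<close> by (simp add: algebra_simps)
  finally show "norm (a + of_real x) \<le> (1 + norm a) * (1 + x)" .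
qed (intro continuous_intros)

lemma rapidly_decreasing_cmult:
  assumes "rapidly_decreasing h"
  shows "rapidly_decreasing (\<lambda>x. a * h x)"
proof (rule rapidly_decreasing_mult[OF assms])
  fix x :: real assume "x > 0"
  thus "norm a \<le> norm a * (1 + x)" by (simp add: algebra_simps)
qed (intro continuous_intros)

lemma rapidly_decreasing_add:
  assumes "rapidly_decreasing g" "rapidly_decreasing h"
  shows "rapidly_decreasing (\<lambda>x. g x + h x)"
  unfolding rapidly_decreasing_def
proof (intro conjI allI)
  show "continuous_on {0<..} (\<lambda>x. g x + h x)"
    using assms by (auto simp: rapidly_decreasing_def intro!: continuous_intros)
  fix m
  obtain B where B: "B > 0" "\<And>x. x > 0 \<Longrightarrow> x ^ m * norm (g x) \<le> B"
    using rapidly_decreasing_bound[OF assms(1)] by blast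
  obtain B' where B': "B' > 0" "\<And>x. x > 0 \<Longrightarrow> x ^ m * norm (h x) \<le> B'"
    using rapidly_decreasing_bound[OF assms(2)] by blast
  have "x ^ m * norm (g x + h x) \<le> B + B'" if x: "x > 0" for x
  proof -
    have "x ^ m * norm (g x + h x) \<le> x ^ m * (norm (g x) + norm (h x))"
      using x by (intro mult_left_mono norm_triangle_ineq) auto
    also have "\<dots> \<le> B + B'" using B(2)[OF x] B'(2)[OF x] by (simp add: algebra_simps)
    finally show ?thesis .
  qed
  thus "\<exists>B. \<forall>x>0. x ^ m * norm (g x + h x) \<le> B" by blast
qed

lemma rapidly_decreasing_exp:
  assumes s: "s > 0"
  shows "rapidly_decreasing (\<lambda>x. of_real (exp (- (s * x))))"
  unfolding rapidly_decreasing_def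
proof (intro conjI allI)
  show "continuous_on {0<..} (\<lambda>x. complex_of_real (exp (- (s * x))))"
    by (intro continuous_intros)
  fix m :: nat
  \<comment> \<open>The constant comes from
    \<open>(s x / m) ^ m \<le> (1 + s x / m) ^ m \<le> exp (s x)\<close>, which needs
    \<open>m > 0\<close>.\<close>
  have "x ^ m * norm (complex_of_real (exp (- (s * x)))) \<le> (real m / s) ^ m" if x: "x > 0" for x
  proof (cases "m = 0")
    case True thus ?thesis using s x by simp
  next
    case False
    have "(s * x / real m) ^ m \<le> (1 + s * x / real m) ^ m"
      using s x by (intro power_mono) auto
    also have "\<dots> \<le> exp (s * x)"
      using s x False by (intro exp_ge_one_plus_x_over_n_power_n) (auto intro: order_trans[of _ 0])
    finally have "(s * x / real m) ^ m \<le> exp (s * x)" .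
    moreover have "x ^ m = (s * x / real m) ^ m * (real m / s) ^ m"
      using s False by (simp flip: power_mult_distrib)
    ultimately have "x ^ m \<le> exp (s * x) * (real m / s) ^ m"
      using s by (metis divide_nonneg_pos mult_right_mono of_nat_0_le_iff zero_le_power)
    thus ?thesis unfolding norm_of_real by (simp add: exp_minus field_simps)
  qed
  thus "\<exists>B. \<forall>x>0. x ^ m * norm (complex_of_real (exp (- (s * x)))) \<le> B" by blast
qed

lemma integrable_powr_rapidly_decreasing_norm:
  assumes a: "a > -1" and h: "rapidly_decreasing h"
  shows "integrable half_line (\<lambda>x. x powr a * norm (h x))"
proof -
  \<comment> \<open>Beyond 1, the decay of order \<open>n\<close> brings \<open>x powr a\<close>
    below a multiple of \<open>x powr (-2)\<close>; up to 1, boundedness of \<open>h\<close> and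
    \<open>a > -1\<close> suffice. The majorant \<open>D\<close> adds the two.\<close>
  obtain n :: nat where n: "real n \<ge> a + 2" using real_arch_simple by blast
  obtain B where B: "B > 0" "\<And>x. x > 0 \<Longrightarrow> x ^ 0 * norm (h x) \<le> B"
    using rapidly_decreasing_bound[OF h] by blast
  obtain B' where B': "B' > 0" "\<And>x. x > 0 \<Longrightarrow> x ^ n * norm (h x) \<le> B'"
    using rapidly_decreasing_bound[OF h] by blast
  have "set_integrable lebesgue {0<..1} (\<lambda>x. x powr a)"
    using a by (intro nonnegative_absolutely_integrable_1 integrable_on_powr_from_0') auto
  hence 1: "integrable lborel (\<lambda>x. indicator {0<..1} x *\<^sub>R x powr a)"
    unfolding set_integrable_def by (subst (asm) integrable_completion) auto
  have "set_integrable lebesgue {1..} (\<lambda>x::real. x powr (-2))"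
    using has_integral_powr_to_inf[of "-2" 1]
    by (intro nonnegative_absolutely_integrable_1) (auto simp: integrable_on_def)
  hence 2: "integrable lborel (\<lambda>x::real. indicator {1..} x *\<^sub>R x powr (-2))"
    unfolding set_integrable_def by (subst (asm) integrable_completion) auto
  define D where "D x = B * (indicator {0<..1} x *\<^sub>R x powr a)
                        + B' * (indicator {1..} x *\<^sub>R x powr (-2))" for x :: real
  have D: "integrable lborel D"
    unfolding D_def by (intro Bochner_Integration.integrable_add integrable_mult_right 1 2)
  have "integrable half_line D"
    unfolding integrable_half_line_iff set_integrable_def by (rule integrable_mult_indicator) (use D in auto)
  thus ?thesis
  proof (rule Bochner_Integration.integrable_bound)
    show "(\<lambda>x. x powr a * norm (h x)) \<in> borel_measurable half_line"
      using h unfolding rapidly_decreasing_def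
      by (intro measurable_half_lineI continuous_intros) auto
    show "AE x in half_line. norm (x powr a * norm (h x)) \<le> norm (D x)"
    proof (rule AE_half_lineI)
      fix x :: real assume x: "x > 0"
      have "x powr a * norm (h x) \<le> D x"
      proof (cases "x \<le> 1")
        case True
        have "x powr a * norm (h x) \<le> x powr a * B"
          using B(2)[OF x] by (intro mult_left_mono) auto
        also have "\<dots> \<le> D x" using True x B' by (simp add: D_def mult_ac)
        finally show ?thesis .
      next
        case False
        have "x powr a * norm (h x) = x powr (a - real n) * (x ^ n * norm (h x))"
          using x by (simp add: powr_diff powr_realpow)
        also have "\<dots> \<le> x powr (a - real n) * B'"
          using B'(2)[OF x] by (intro mult_left_mono) auto
        also have "\<dots> \<le> x powr (-2) * B'"
          using False n B' by (intro mult_right_mono powr_mono) auto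
        also have "\<dots> = D x" using False by (simp add: D_def)
        finally show ?thesis .
      qed
      thus "norm (x powr a * norm (h x)) \<le> norm (D x)" by simp
    qed
  qed
qed

lemma integrable_powr_rapidly_decreasing:
  assumes "Re \<nu> > -1" and h: "rapidly_decreasing h"
  shows "integrable half_line (\<lambda>x. of_real x powr \<nu> * h x)"
proof (rule Bochner_Integration.integrable_bound)
  show "integrable half_line (\<lambda>x. x powr Re \<nu> * norm (h x))"
    by (rule integrable_powr_rapidly_decreasing_norm[OF assms])
  show "(\<lambda>x. of_real x powr \<nu> * h x) \<in> borel_measurable half_line"
    using h by (intro measurable_half_lineI continuous_on_mult continuous_on_of_real_powr)
               (auto simp: rapidly_decreasing_def)
  show "AE x in half_line. norm (of_real x powr \<nu> * h x) \<le> norm (x powr Re \<nu> * norm (h x))"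
    by (rule AE_half_lineI) (simp add: norm_mult norm_powr_real_powr)
qed

lemma norm_one_plus_of_real:
  assumes "x \<ge> 0"
  shows "norm (1 + complex_of_real x) = 1 + x"
proof -
  have "1 + complex_of_real x = of_real (1 + x)" by simp
  thus ?thesis using assms by (simp only: norm_of_real)
qed

subsection \<open>The Bessel-Clifford transform\<close>

definition clifford_transform :: "complex \<Rightarrow> (real \<Rightarrow> complex) \<Rightarrow> real \<Rightarrow> complex" where
  "clifford_transform \<nu> h y =
     (\<integral>x. of_real x powr \<nu> * (bessel_clifford \<nu> (of_real (x * y)) * h x) \<partial>half_line)"

lemma continuous_on_bessel_clifford_mult:
  assumes "Re \<nu> > -1"
  shows "continuous_on A (\<lambda>x. bessel_clifford \<nu> (of_real (x * y)))"
  by (rule continuous_on_compose2[OF continuous_on_bessel_clifford[OF assms, of UNIV]])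
     (auto intro!: continuous_intros)

text \<open>Bounding \<open>1 + x y\<close> by \<open>(1 + x) (1 + y)\<close> separates the
  variables, as domination and Fubini require.\<close>

lemma bessel_clifford_mult_bound:
  assumes "Re \<nu> > -1"
  obtains K where "K > 0"
    "\<And>x y. x \<ge> 0 \<Longrightarrow> y \<ge> 0 \<Longrightarrow> norm (bessel_clifford \<nu> (of_real (x * y))) \<le> K * (1 + y) * (1 + x)"
proof -
  obtain K where K: "K > 0" "\<And>t. t \<ge> 0 \<Longrightarrow> norm (bessel_clifford \<nu> (of_real t)) \<le> K * (1 + t)"
    by (rule bessel_clifford_linear_bound[OF assms]) (rule that)
  show ?thesis
  proof (rule that[OF K(1)])
    fix x y :: real assume xy: "x \<ge> 0" "y \<ge> 0"
    have "norm (bessel_clifford \<nu> (of_real (x * y))) \<le> K * (1 + x * y)"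
      using xy by (intro K) auto
    also have "\<dots> \<le> K * ((1 + y) * (1 + x))"
      using xy K(1) by (intro mult_left_mono) (auto simp: algebra_simps)
    finally show "norm (bessel_clifford \<nu> (of_real (x * y))) \<le> K * (1 + y) * (1 + x)"
      by (simp add: mult_ac)
  qed
qed

lemma rapidly_decreasing_bessel_clifford_mult:
  assumes \<nu>: "Re \<nu> > -1" and h: "rapidly_decreasing h" and "y \<ge> 0"
  shows "rapidly_decreasing (\<lambda>x. bessel_clifford \<nu> (of_real (x * y)) * h x)"
proof -
  obtain K where K: "K > 0" "\<And>x y. x \<ge> 0 \<Longrightarrow> y \<ge> 0 \<Longrightarrow>
      norm (bessel_clifford \<nu> (of_real (x * y))) \<le> K * (1 + y) * (1 + x)"
    by (rule bessel_clifford_mult_bound[OF \<nu>]) (rule that)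
  show ?thesis
    by (rule rapidly_decreasing_mult[OF h continuous_on_bessel_clifford_mult[OF \<nu>] K(2)])
       (use assms in auto)
qed

lemma integrable_clifford_transform:
  assumes "Re \<nu> > -1" "rapidly_decreasing h" "y \<ge> 0"
  shows "integrable half_line
           (\<lambda>x. of_real x powr \<nu> * (bessel_clifford \<nu> (of_real (x * y)) * h x))"
  by (intro integrable_powr_rapidly_decreasing rapidly_decreasing_bessel_clifford_mult assms)

text \<open>A single majorant for all \<open>y\<close>, up to the factor \<open>1 + y\<close>,
  serves the growth bound, continuity by dominated convergence and the Fubini argument
  alike.\<close>

lemma clifford_transform_dominated:
  assumes \<nu>: "Re \<nu> > -1" and h: "rapidly_decreasing h"
  obtains w where "integrable half_line w" "\<And>x. w x \<ge> 0"
    "\<And>x y. x > 0 \<Longrightarrow> y \<ge> 0 \<Longrightarrow>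
       norm (of_real x powr \<nu> * (bessel_clifford \<nu> (of_real (x * y)) * h x)) \<le> (1 + y) * w x"
proof -
  obtain K where K: "K > 0" "\<And>x y. x \<ge> 0 \<Longrightarrow> y \<ge> 0 \<Longrightarrow>
      norm (bessel_clifford \<nu> (of_real (x * y))) \<le> K * (1 + y) * (1 + x)"
    by (rule bessel_clifford_mult_bound[OF \<nu>]) (rule that)
  define w where "w x = K * (x powr Re \<nu> * norm ((1 + of_real x) * h x))" for x :: real
  show ?thesis
  proof (rule that[of w])
    show "integrable half_line w"
      unfolding w_def by (intro integrable_mult_right integrable_powr_rapidly_decreasing_norm
        rapidly_decreasing_mult_linear \<nu> h)
    show "w x \<ge> 0" for x using K(1) by (simp add: w_def)
    fix x y :: real assume xy: "x > 0" "y \<ge> 0"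
    have "norm (of_real x powr \<nu> * (bessel_clifford \<nu> (of_real (x * y)) * h x))
       = norm (bessel_clifford \<nu> (of_real (x * y))) * (x powr Re \<nu> * norm (h x))"
      using xy by (simp add: norm_mult norm_powr_real_powr mult_ac del: of_real_mult)
    also have "\<dots> \<le> (K * (1 + y) * (1 + x)) * (x powr Re \<nu> * norm (h x))"
      using xy by (intro mult_right_mono K) auto
    also have "\<dots> = (1 + y) * w x"
      using xy by (simp add: w_def norm_mult norm_one_plus_of_real)
    finally show "norm (of_real x powr \<nu> * (bessel_clifford \<nu> (of_real (x * y)) * h x))
                       \<le> (1 + y) * w x" .
  qed
qed

lemma clifford_transform_linear_bound:
  assumes \<nu>: "Re \<nu> > -1" and h: "rapidly_decreasing h"
  obtains K where "\<And>y. y \<ge> 0 \<Longrightarrow> norm (clifford_transform \<nu> h y) \<le> K * (1 + y)"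
proof -
  obtain w where w: "integrable half_line w" "\<And>x. w x \<ge> 0"
    "\<And>x y. x > 0 \<Longrightarrow> y \<ge> 0 \<Longrightarrow>
       norm (of_real x powr \<nu> * (bessel_clifford \<nu> (of_real (x * y)) * h x)) \<le> (1 + y) * w x"
    by (rule clifford_transform_dominated[OF assms]) (rule that)
  show ?thesis
  proof (rule that[of "integral\<^sup>L half_line w"])
    fix y :: real assume y: "y \<ge> 0"
    have "norm (clifford_transform \<nu> h y) \<le> (\<integral>x. (1 + y) * w x \<partial>half_line)"
      unfolding clifford_transform_def
      by (intro Bochner_Integration.integral_norm_bound_integral integrable_clifford_transform assms y
                integrable_mult_right w) (use w(3) y in \<open>auto simp: space_restrict_space\<close>)
    thus "norm (clifford_transform \<nu> h y) \<le> integral\<^sup>L half_line w * (1 + y)"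
      by (simp add: mult.commute)
  qed
qed

lemma continuous_on_clifford_transform:
  assumes \<nu>: "Re \<nu> > -1" and h: "rapidly_decreasing h"
  shows "continuous_on {0..} (clifford_transform \<nu> h)"
proof (rule continuous_on_sequentiallyI)
  fix u :: "nat \<Rightarrow> real" and a
  assume u: "\<forall>n. u n \<in> {0..}" and a: "a \<in> {0..}" and lim: "u \<longlonglongrightarrow> a"
  obtain w where w: "integrable half_line w" "\<And>x. w x \<ge> 0"
    "\<And>x y. x > 0 \<Longrightarrow> y \<ge> 0 \<Longrightarrow>
       norm (of_real x powr \<nu> * (bessel_clifford \<nu> (of_real (x * y)) * h x)) \<le> (1 + y) * w x"
    by (rule clifford_transform_dominated[OF assms]) (rule that)
  \<comment> \<open>A convergent sequence is bounded, so \<open>(1 + Y) * w x\<close> dominates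
    every integrand.\<close>
  obtain Y where Y: "\<And>n. norm (u n) \<le> Y"
    using convergent_imp_Bseq[OF convergentI[OF lim]] by (auto simp: Bseq_def)
  show "(\<lambda>n. clifford_transform \<nu> h (u n)) \<longlonglongrightarrow> clifford_transform \<nu> h a"
    unfolding clifford_transform_def
  proof (rule integral_dominated_convergence)
    show "integrable half_line (\<lambda>x. (1 + Y) * w x)" by (intro integrable_mult_right w)
    have "(\<lambda>x. of_real x powr \<nu> * (bessel_clifford \<nu> (of_real (x * y)) * h x))
            \<in> borel_measurable half_line" if "y \<ge> 0" for y
      using integrable_clifford_transform[OF assms that] by (rule borel_measurable_integrable)
    thus "(\<lambda>x. of_real x powr \<nu> * (bessel_clifford \<nu> (of_real (x * a)) * h x))
            \<in> borel_measurable half_line"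
      and "(\<lambda>x. of_real x powr \<nu> * (bessel_clifford \<nu> (of_real (x * u n)) * h x))
            \<in> borel_measurable half_line" for n
      using a u by auto
    have "isCont (bessel_clifford \<nu>) z" for z
      by (rule DERIV_isCont[OF DERIV_bessel_clifford[OF \<nu>]])
    thus "AE x in half_line. (\<lambda>n. of_real x powr \<nu> * (bessel_clifford \<nu> (of_real (x * u n)) * h x))
            \<longlonglongrightarrow> of_real x powr \<nu> * (bessel_clifford \<nu> (of_real (x * a)) * h x)"
      using lim by (intro AE_I2 tendsto_intros isCont_tendsto_compose[of _ "bessel_clifford \<nu>"])
    fix n
    show "AE x in half_line. norm (of_real x powr \<nu> * (bessel_clifford \<nu> (of_real (x * u n)) * h x))
            \<le> (1 + Y) * w x"
    proof (rule AE_half_lineI)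
      fix x :: real assume "x > 0"
      hence "norm (of_real x powr \<nu> * (bessel_clifford \<nu> (of_real (x * u n)) * h x))
              \<le> (1 + u n) * w x"
        using u w(3) by auto
      also have "\<dots> \<le> (1 + Y) * w x"
        using Y[of n] u w(2) by (intro mult_right_mono) auto
      finally show "norm (of_real x powr \<nu> * (bessel_clifford \<nu> (of_real (x * u n)) * h x))
              \<le> (1 + Y) * w x" .
    qed
  qed
qed

text \<open>The kernel depends only on the product of the two variables, so the claim is an exchange
  of integrals.\<close>

lemma clifford_transform_symmetric:
  assumes \<nu>: "Re \<nu> > -1" and g: "rapidly_decreasing g" and h: "rapidly_decreasing h"
  shows "(\<integral>y. of_real y powr \<nu> * (g y * clifford_transform \<nu> h y) \<partial>half_line)
       = (\<integral>x. of_real x powr \<nu> * (h x * clifford_transform \<nu> g x) \<partial>half_line)"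
proof -
  define F where "F x y = (of_real y powr \<nu> * g y)
      * (of_real x powr \<nu> * (bessel_clifford \<nu> (of_real (x * y)) * h x))" for x y
  obtain w where w: "integrable half_line w" "\<And>x. w x \<ge> 0"
    "\<And>x y. x > 0 \<Longrightarrow> y \<ge> 0 \<Longrightarrow>
       norm (of_real x powr \<nu> * (bessel_clifford \<nu> (of_real (x * y)) * h x)) \<le> (1 + y) * w x"
    by (rule clifford_transform_dominated[OF \<nu> h]) (rule that)
  \<comment> \<open>The factor \<open>1 + y\<close> left by the majorant \<open>w\<close> is
    absorbed by the decay of \<open>g\<close>, so that a product of two integrable functions
    dominates \<open>F\<close>.\<close>
  define v where "v y = y powr Re \<nu> * norm ((1 + of_real y) * g y)" for y :: real
  have v: "integrable half_line v"
    unfolding v_def by (intro integrable_powr_rapidly_decreasing_norm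
        rapidly_decreasing_mult_linear \<nu> g)
  have v0: "v y \<ge> 0" for y by (simp add: v_def)
  note [measurable] = borel_measurable_integrable[OF v] borel_measurable_integrable[OF w(1)]
  have [measurable]: "g \<in> borel_measurable half_line" "h \<in> borel_measurable half_line"
    "(\<lambda>x. complex_of_real x powr \<nu>) \<in> borel_measurable half_line"
    "bessel_clifford \<nu> \<in> borel_measurable borel"
    "(\<lambda>x. x) \<in> borel_measurable half_line"
    using g h \<nu> by (auto intro!: measurable_half_lineI continuous_on_of_real_powr
      borel_measurable_continuous_onI continuous_on_bessel_clifford continuous_intros
      simp: rapidly_decreasing_def)
  have "integrable (half_line \<Otimes>\<^sub>M half_line) (\<lambda>(x, y). w x * v y)"
  proof (rule half_line_pair.Fubini_integrable)
    show "integrable half_line (\<lambda>x. \<integral>y. norm (case (x, y) of (x, y) \<Rightarrow> w x * v y) \<partial>half_line)"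
      using w v v0 by (simp add: abs_mult)
  qed (use v in auto)
  hence "integrable (half_line \<Otimes>\<^sub>M half_line) (case_prod F)"
  proof (rule Bochner_Integration.integrable_bound)
    show "case_prod F \<in> borel_measurable (half_line \<Otimes>\<^sub>M half_line)"
      unfolding F_def by measurable
    show "AE z in half_line \<Otimes>\<^sub>M half_line. norm (case_prod F z) \<le> norm (case z of (x, y) \<Rightarrow> w x * v y)"
    proof (rule AE_I2)
      fix z assume "z \<in> space (half_line \<Otimes>\<^sub>M half_line)"
      then obtain x y where z: "z = (x, y)" "x > 0" "y > 0"
        by (auto simp: space_pair_measure space_restrict_space)
      have "norm (F x y) \<le> (y powr Re \<nu> * norm (g y)) * ((1 + y) * w x)"
        unfolding F_def norm_mult[of "of_real y powr \<nu> * g y"]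
        by (intro mult_mono w(3)) (use z in \<open>auto simp: norm_mult norm_powr_real_powr\<close>)
      hence "norm (F x y) \<le> w x * v y"
        using z by (simp add: v_def norm_mult norm_one_plus_of_real mult_ac)
      thus "norm (case_prod F z) \<le> norm (case z of (x, y) \<Rightarrow> w x * v y)"
        using z by simp
    qed
  qed
  hence "(\<integral>y. (\<integral>x. F x y \<partial>half_line) \<partial>half_line) = (\<integral>x. (\<integral>y. F x y \<partial>half_line) \<partial>half_line)"
    by (rule half_line_pair.Fubini_integral)
  moreover have "(\<integral>x. F x y \<partial>half_line) = of_real y powr \<nu> * (g y * clifford_transform \<nu> h y)" for y
    by (simp add: F_def clifford_transform_def mult.assoc)
  moreover have "(\<integral>y. F x y \<partial>half_line) = of_real x powr \<nu> * (h x * clifford_transform \<nu> g x)" for x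
  proof -
    have "(\<integral>y. F x y \<partial>half_line) = (\<integral>y. (of_real x powr \<nu> * h x)
       * (of_real y powr \<nu> * (bessel_clifford \<nu> (of_real (y * x)) * g y)) \<partial>half_line)"
      by (simp add: F_def mult_ac)
    also have "\<dots> = (of_real x powr \<nu> * h x) * clifford_transform \<nu> g x"
      unfolding clifford_transform_def by (rule integral_mult_right_zero)
    finally show ?thesis by (simp add: mult.assoc)
  qed
  ultimately show ?thesis by simp
qed

section \<open>Transforms of exponentials\<close>

lemma has_bochner_integral_Gamma_exp:
  assumes z: "Re z > 0" and s: "s > 0"
  shows "has_bochner_integral half_line
           (\<lambda>x. of_real x powr (z - 1) * of_real (exp (- (s * x))))
           (Gamma z * of_real s powr (- z))"
proof -
  define f where "f x = indicator {0<..} x *\<^sub>R (complex_of_real x powr (z - 1) / of_real (exp x))" for x :: real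
  have "integrable lebesgue f"
    using absolutely_integrable_Gamma_integral'[OF z] by (simp add: f_def[abs_def] set_integrable_def)
  moreover have f_meas: "f \<in> borel_measurable lborel"
    unfolding f_def[abs_def] using continuous_on_of_real_powr
    by (auto intro!: borel_measurable_continuous_on_indicator continuous_intros)
  ultimately have int: "integrable lborel f" by (simp add: integrable_completion)
  have "integral\<^sup>L lborel f = Gamma z"
  proof -
    have "integral\<^sup>L lebesgue f = integral {0<..} (\<lambda>x. complex_of_real x powr (z - 1) / of_real (exp x))"
      using set_lebesgue_integral_eq_integral(2)[OF absolutely_integrable_Gamma_integral'[OF z]]
      by (simp add: f_def[abs_def] set_lebesgue_integral_def)
    also have "\<dots> = Gamma z" using Gamma_integral_complex'[OF z] by (rule integral_unique)
    finally show ?thesis using f_meas by (simp add: integral_completion)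
  qed
  with int have "has_bochner_integral lborel f (Gamma z)" by (simp add: has_bochner_integral_iff)
  hence "has_bochner_integral lborel (\<lambda>x. f (0 + s * x)) (Gamma z /\<^sub>R \<bar>s\<bar>)"
    using s by (subst (asm) lborel_has_bochner_integral_real_affine_iff[of s _ _ 0]) auto
  \<comment> \<open>The factor \<open>s powr (1 - z)\<close> removes the power of \<open>s\<close>
    from \<open>(s x) powr (z - 1)\<close>; with the Jacobian \<open>1 / s\<close> it leaves
    \<open>s powr (- z)\<close>.\<close>
  hence "has_bochner_integral lborel (\<lambda>x. of_real s powr (1 - z) * f (0 + s * x))
           (of_real s powr (1 - z) * (Gamma z /\<^sub>R \<bar>s\<bar>))"
    by (rule has_bochner_integral_mult_right)
  also have "(\<lambda>x. of_real s powr (1 - z) * f (0 + s * x))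
      = (\<lambda>x. indicator {0<..} x *\<^sub>R (of_real x powr (z - 1) * of_real (exp (- (s * x)))))"
  proof
    fix x
    show "of_real s powr (1 - z) * f (0 + s * x)
        = indicator {0<..} x *\<^sub>R (of_real x powr (z - 1) * of_real (exp (- (s * x))))"
    proof (cases "x > 0")
      case True
      have "complex_of_real (s * x) powr (z - 1) = of_real s powr (z - 1) * of_real x powr (z - 1)"
        using s True by (simp add: powr_times_real)
      moreover have "complex_of_real s powr (1 - z) * of_real s powr (z - 1) = 1"
        using s by (simp flip: powr_add)
      ultimately show ?thesis
        using s True by (simp add: f_def exp_minus field_simps)
    next
      case False
      thus ?thesis using s by (simp add: f_def zero_less_mult_iff)
    qed
  qed
  also have "of_real s powr (1 - z) * (Gamma z /\<^sub>R \<bar>s\<bar>) = Gamma z * of_real s powr (- z)"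
    using s powr_add[of "complex_of_real s" 1 "-z"] by (simp add: scaleR_conv_of_real field_simps)
  finally show ?thesis
    by (simp add: has_bochner_integral_iff integrable_half_line_iff integral_half_line_eq
          set_integrable_def set_lebesgue_integral_def)
qed

text \<open>
  The Gamma integral turns the series of the kernel into an exponential series term by term.
\<close>

lemma clifford_transform_exp:
  assumes \<nu>: "Re \<nu> > -1" and s: "s > 0" and y: "y \<ge> 0"
  shows "clifford_transform \<nu> (\<lambda>x. of_real (exp (- (s * x)))) y
           = of_real s powr (- \<nu> - 1) * of_real (exp (- (y / s)))"
proof -
  define c where "c = bessel_clifford_coeff \<nu>"
  define a where "a = Re \<nu> + 1"
  have a: "a > 0" using \<nu> by (simp add: a_def)
  \<comment> \<open>The exponent keeps the form \<open>z - 1\<close> with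
    \<open>z = k + \<nu> + 1\<close>, to match the Gamma integral.\<close>
  define f where "f k x = c k * of_real y ^ k
      * (of_real x powr (of_nat k + \<nu> + 1 - 1) * of_real (exp (- (s * x))))" for k and x :: real
  have f: "has_bochner_integral half_line (f k)
      (c k * of_real y ^ k * (Gamma (of_nat k + \<nu> + 1) * of_real s powr (- (of_nat k + \<nu> + 1))))" for k
    unfolding f_def using \<nu> s
    by (intro has_bochner_integral_mult_right has_bochner_integral_Gamma_exp) auto
  have f_eq: "f k x = of_real x powr \<nu> * (c k * of_real (x * y) ^ k * of_real (exp (- (s * x))))"
    if "x > 0" for k x
    using that by (simp add: f_def powr_add power_mult_distrib mult_ac)
  have norm_f: "norm (f k x) = norm (c k) * y ^ k * norm (complex_of_real x
        powr (complex_of_real (real k + a) - 1) * of_real (exp (- (s * x))))" if "x > 0" for k x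
    using that y by (simp add: f_def a_def norm_mult norm_power norm_powr_real_powr)
  \<comment> \<open>Taking norms replaces \<open>\<nu>\<close> by its real part in the power of
    \<open>x\<close>, so the absolute integrals are real Gamma integrals with parameter
    \<open>k + a\<close>.\<close>
  define v where "v k = norm (c k) * Gamma (real k + a)" for k
  have int_norm: "(\<integral>x. norm (f k x) \<partial>half_line) = v k * s powr (- a) * (y / s) ^ k" for k
  proof -
    have "has_bochner_integral half_line (\<lambda>x. complex_of_real (x powr (real k + a - 1) * exp (- (s * x))))
        (of_real (Gamma (real k + a) * s powr (- (real k + a))))"
    proof (rule has_bochner_integral_cong[THEN iffD1, OF refl _ _ has_bochner_integral_Gamma_exp])
      show "0 < Re (complex_of_real (real k + a))" "0 < s" using a s by auto
      show "complex_of_real x powr (complex_of_real (real k + a) - 1) * of_real (exp (- (s * x)))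
          = complex_of_real (x powr (real k + a - 1) * exp (- (s * x)))" if "x \<in> space half_line" for x
        using that powr_of_real[of x "real k + a - 1"] by (simp add: space_restrict_space)
      show "Gamma (complex_of_real (real k + a)) * of_real s powr (- complex_of_real (real k + a))
          = of_real (Gamma (real k + a) * s powr (- (real k + a)))"
        by (simp only: Gamma_complex_of_real of_real_mult of_real_minus
              powr_of_real[OF less_imp_le[OF s], symmetric])
    qed
    hence "(\<integral>x. x powr (real k + a - 1) * exp (- (s * x)) \<partial>half_line)
          = Gamma (real k + a) * s powr (- (real k + a))"
      by (auto simp only: has_bochner_integral_iff integral_complex_of_real of_real_eq_iff)
    moreover have "(\<integral>x. norm (f k x) \<partial>half_line)
        = (\<integral>x. norm (c k) * y ^ k * (x powr (real k + a - 1) * exp (- (s * x))) \<partial>half_line)"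
      by (rule integral_half_line_cong) (simp add: norm_f norm_mult norm_powr_real_powr)
    ultimately have "(\<integral>x. norm (f k x) \<partial>half_line)
        = norm (c k) * y ^ k * (Gamma (real k + a) * s powr (- (real k + a)))" by simp
    also have "- (real k + a) = - a - real k" by simp
    also have "s powr (- a - real k) = s powr (- a) / s ^ k"
      using s by (simp only: powr_diff powr_realpow)
    finally show ?thesis by (simp add: v_def power_divide)
  qed
  \<comment> \<open>The functional equation of Gamma supplies the factor \<open>k + a\<close>, which
    is the one in the coefficient estimate. Hence \<open>(k + 1) * v (k + 1) \<le> v k\<close>, and
    an exponential series majorizes the absolute integrals.\<close>
  have v: "0 \<le> v k \<and> v k \<le> v 0 / fact k" for k
  proof (induction k)
    case 0 thus ?case using a by (simp add: v_def)
  next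
    case (Suc k)
    have nz: "real k + a \<notin> \<int>\<^sub>\<le>\<^sub>0" using a by (auto elim!: nonpos_Ints_cases')
    have "real (Suc k) * v (Suc k)
        = ((real k + Re \<nu> + 1) * real (Suc k) * norm (c (Suc k))) * Gamma (real k + a)"
      using Gamma_plus1[OF nz] by (simp add: v_def a_def add_ac mult_ac)
    also have "\<dots> \<le> norm (c k) * Gamma (real k + a)"
      unfolding c_def using a by (intro mult_right_mono norm_bessel_clifford_coeff_Suc \<nu>) auto
    also have "\<dots> \<le> v 0 / fact k" using Suc by (simp add: v_def)
    finally have "v (Suc k) \<le> v 0 / fact (Suc k)"
      by (simp add: field_simps del: of_nat_Suc)
    moreover have "0 \<le> v (Suc k)" using a by (simp add: v_def)
    ultimately show ?case by simp
  qed
  have "summable (\<lambda>k. v k * s powr (- a) * (y / s) ^ k)"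
  proof (rule summable_comparison_test')
    show "summable (\<lambda>k. v 0 * s powr (- a) * ((y / s) ^ k /\<^sub>R fact k))"
      by (intro summable_mult summable_exp_generic)
    fix k
    have "v k * s powr (- a) * (y / s) ^ k \<le> v 0 / fact k * s powr (- a) * (y / s) ^ k"
      using v[of k] s y by (intro mult_right_mono) auto
    thus "norm (v k * s powr (- a) * (y / s) ^ k) \<le> v 0 * s powr (- a) * ((y / s) ^ k /\<^sub>R fact k)"
      using v[of k] s y by (simp add: field_simps)
  qed
  hence sum_int: "summable (\<lambda>k. \<integral>x. norm (f k x) \<partial>half_line)" by (simp only: int_norm)
  have sum_f: "summable (\<lambda>k. norm (f k x))" if "x > 0" for x
    unfolding f_eq[OF that] norm_mult[of "_ powr _"] norm_mult[of _ "of_real (exp _)"]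
    by (intro summable_mult summable_mult2 summable_norm_bessel_clifford[OF \<nu>, folded c_def])
  have T: "clifford_transform \<nu> (\<lambda>x. of_real (exp (- (s * x)))) y = (\<integral>x. (\<Sum>k. f k x) \<partial>half_line)"
    unfolding clifford_transform_def
  proof (rule integral_half_line_cong)
    fix x :: real assume x: "x > 0"
    have "(\<lambda>k. c k * of_real (x * y) ^ k) sums bessel_clifford \<nu> (of_real (x * y))"
      unfolding bessel_clifford_def c_def by (rule summable_sums[OF summable_bessel_clifford[OF \<nu>]])
    hence "(\<lambda>k. f k x) sums (of_real x powr \<nu>
              * (bessel_clifford \<nu> (of_real (x * y)) * of_real (exp (- (s * x)))))"
      unfolding f_eq[OF x] by (intro sums_mult sums_mult2)
    thus "of_real x powr \<nu> * (bessel_clifford \<nu> (of_real (x * y)) * of_real (exp (- (s * x))))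
          = (\<Sum>k. f k x)" by (rule sums_unique)
  qed
  have "(\<lambda>k. integral\<^sup>L half_line (f k)) sums (\<integral>x. (\<Sum>k. f k x) \<partial>half_line)"
    by (rule sums_integral[OF _ AE_half_lineI[OF sum_f] sum_int])
       (use f in \<open>auto simp: has_bochner_integral_iff\<close>)
  hence "(\<lambda>k. c k * of_real y ^ k * (Gamma (of_nat k + \<nu> + 1) * of_real s powr (- (of_nat k + \<nu> + 1)))) sums
          (\<integral>x. (\<Sum>k. f k x) \<partial>half_line)"
    using f by (simp add: has_bochner_integral_iff)
  moreover have "c k * of_real y ^ k * (Gamma (of_nat k + \<nu> + 1) * of_real s powr (- (of_nat k + \<nu> + 1)))
      = of_real s powr (- \<nu> - 1) * (of_real (- (y / s)) ^ k /\<^sub>R fact k)" for k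
  proof -
    have "of_nat k + \<nu> + 1 \<notin> \<int>\<^sub>\<le>\<^sub>0"
    proof
      assume "of_nat k + \<nu> + 1 \<in> \<int>\<^sub>\<le>\<^sub>0"
      then obtain n where "of_nat k + \<nu> + 1 = - of_nat n" by (auto elim!: nonpos_Ints_cases')
      hence "Re (of_nat k + \<nu> + 1) = Re (- of_nat n)" by simp
      thus False using \<nu> by simp
    qed
    hence "rGamma (of_nat k + \<nu> + 1) * Gamma (of_nat k + \<nu> + 1) = 1"
      by (simp add: rGamma_inverse_Gamma Gamma_eq_zero_iff)
    hence cG: "c k * Gamma (of_nat k + \<nu> + 1) = (-1) ^ k / fact k"
      by (simp add: c_def bessel_clifford_coeff_def)
    have sp: "complex_of_real s powr (- (of_nat k + \<nu> + 1))
        = of_real s powr (- \<nu> - 1) / of_real s ^ k"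
    proof -
      have "complex_of_real s powr (- (of_nat k + \<nu> + 1)) = of_real s powr ((- \<nu> - 1) - of_nat k)"
        by (rule arg_cong[where f = "(powr) (complex_of_real s)"]) simp
      also have "\<dots> = of_real s powr (- \<nu> - 1) / of_real s powr of_nat k"
        by (rule powr_diff)
      finally show ?thesis using s by simp
    qed
    have pw: "complex_of_real (- (y / s)) ^ k = (-1) ^ k * of_real y ^ k / of_real s ^ k"
      using power_minus[of "complex_of_real y / of_real s" k] by (simp add: power_divide)
    have "c k * of_real y ^ k * (Gamma (of_nat k + \<nu> + 1) * of_real s powr (- (of_nat k + \<nu> + 1)))
        = (c k * Gamma (of_nat k + \<nu> + 1)) * of_real y ^ k * of_real s powr (- (of_nat k + \<nu> + 1))"
      by (simp only: mult_ac)
    also have "\<dots> = of_real s powr (- \<nu> - 1) * (of_real (- (y / s)) ^ k /\<^sub>R fact k)"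
      unfolding cG sp pw scaleR_conv_of_real by (simp add: divide_inverse mult_ac)
    finally show ?thesis .
  qed
  ultimately have "(\<lambda>k. of_real s powr (- \<nu> - 1) * (of_real (- (y / s)) ^ k /\<^sub>R fact k)) sums
          (\<integral>x. (\<Sum>k. f k x) \<partial>half_line)" by simp
  moreover have "(\<lambda>k. of_real s powr (- \<nu> - 1) * (complex_of_real (- (y / s)) ^ k /\<^sub>R fact k)) sums
          (of_real s powr (- \<nu> - 1) * exp (of_real (- (y / s))))"
    by (intro sums_mult exp_converges)
  ultimately have "(\<integral>x. (\<Sum>k. f k x) \<partial>half_line) = of_real s powr (- \<nu> - 1) * exp (of_real (- (y / s)))"
    by (rule sums_unique2)
  thus ?thesis by (simp only: T exp_of_real)
qed

subsection \<open>Uniqueness of the Laplace transform and inversion\<close>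

text \<open>
  In the variable \<open>u = exp (- x)\<close> the hypotheses say that all moments vanish, so by the
  Weierstrass approximation theorem \<open>\<phi>\<close> integrates to \<open>0\<close> against a bump near any point.
\<close>

lemma laplace_transform_unique_real:
  fixes \<phi> :: "real \<Rightarrow> real"
  assumes cont: "continuous_on {0<..} \<phi>"
    and int: "integrable half_line (\<lambda>x. exp (- x) * \<phi> x)"
    and zero: "\<And>n::nat. (\<integral>x. exp (- (real (Suc n) * x)) * \<phi> x \<partial>half_line) = 0"
    and "x0 > 0"
  shows "\<phi> x0 = 0"
proof (rule ccontr)
  assume nz: "\<phi> x0 \<noteq> 0"
  have int_mult: "integrable half_line (\<lambda>x. q (exp (- x)) * (exp (- x) * \<phi> x))"
    if q: "continuous_on {0..1} q" for q :: "real \<Rightarrow> real"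
  proof -
    have "bounded (q ` {0..1})"
      by (intro compact_imp_bounded compact_continuous_image q) auto
    then obtain B where "\<forall>u\<in>{0..1}. norm (q u) \<le> B" by (auto simp: bounded_iff)
    hence B: "norm (q u) \<le> B" if "u \<in> {0..1}" for u using that by blast
    have "continuous_on {0<..} (\<lambda>x. q (exp (- x)) * (exp (- x) * \<phi> x))"
      by (intro continuous_on_mult continuous_on_compose2[OF q] cont continuous_intros) auto
    hence "(\<lambda>x. q (exp (- x)) * (exp (- x) * \<phi> x)) \<in> borel_measurable half_line"
      by (rule measurable_half_lineI)
    thus ?thesis
      by (intro Bochner_Integration.integrable_bound[OF integrable_mult_right[OF int, of B]] AE_half_lineI)
         (auto simp: abs_mult intro!: mult_mono order_trans[OF B[unfolded real_norm_def] abs_ge_self])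
  qed
  have poly: "(\<integral>x. p (exp (- x)) * (exp (- x) * \<phi> x) \<partial>half_line) = 0"
    if "real_polynomial_function p" for p :: "real \<Rightarrow> real"
  proof -
    from that obtain a n where p: "p = (\<lambda>x. \<Sum>i\<le>n. a i * x ^ i)"
      by (auto simp: real_polynomial_function_iff_sum)
    \<comment> \<open>The weight \<open>exp (- x)\<close> contributes one power, so degree
      \<open>i\<close> meets the hypothesis with rate \<open>Suc i\<close>. Without that weight
      \<open>\<phi>\<close> need not be integrable.\<close>
    have eq: "exp (- x) ^ i * (exp (- x) * \<phi> x) = exp (- (real (Suc i) * x)) * \<phi> x" for i :: nat and x :: real
      by (simp add: algebra_simps flip: exp_of_nat_mult exp_add)
    have "(\<integral>x. p (exp (- x)) * (exp (- x) * \<phi> x) \<partial>half_line)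
        = (\<integral>x. (\<Sum>i\<le>n. a i * (exp (- x) ^ i * (exp (- x) * \<phi> x))) \<partial>half_line)"
      by (simp add: p sum_distrib_right mult.assoc)
    also have "\<dots> = (\<Sum>i\<le>n. a i * (\<integral>x. exp (- x) ^ i * (exp (- x) * \<phi> x) \<partial>half_line))"
      by (subst Bochner_Integration.integral_sum)
         (auto intro!: integrable_mult_right int_mult[of "\<lambda>u. u ^ i" for i] continuous_intros)
    also have "\<dots> = 0" by (simp only: eq zero) simp
    finally show ?thesis .
  qed
  have cont_zero: "(\<integral>x. q (exp (- x)) * (exp (- x) * \<phi> x) \<partial>half_line) = 0"
    if q: "continuous_on {0..1} q" for q :: "real \<Rightarrow> real"
  proof -
    define A where "A = (\<integral>x. \<bar>exp (- x) * \<phi> x\<bar> \<partial>half_line)"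
    have "\<bar>\<integral>x. q (exp (- x)) * (exp (- x) * \<phi> x) \<partial>half_line\<bar> \<le> 0 + e" if "e > 0" for e
    proof -
      have A: "A \<ge> 0" by (simp add: A_def)
      hence "e / (A + 1) > 0" using \<open>e > 0\<close> by simp
      then obtain p where p: "real_polynomial_function p" "\<And>u. u \<in> {0..1} \<Longrightarrow> \<bar>q u - p u\<bar> < e / (A + 1)"
        using Stone_Weierstrass_real_polynomial_function[OF compact_Icc q] by blast
      have cp: "continuous_on {0..1} p"
        using p(1) by (intro continuous_on_polymonial_function) (simp add: real_polynomial_function_eq)
      have "(\<integral>x. q (exp (- x)) * (exp (- x) * \<phi> x) \<partial>half_line)
          = (\<integral>x. (q (exp (- x)) - p (exp (- x))) * (exp (- x) * \<phi> x) \<partial>half_line)"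
        unfolding left_diff_distrib
        by (subst Bochner_Integration.integral_diff[OF int_mult[OF q] int_mult[OF cp]])
           (simp add: poly[OF p(1)])
      also have "\<bar>\<dots>\<bar> \<le> (\<integral>x. e / (A + 1) * \<bar>exp (- x) * \<phi> x\<bar> \<partial>half_line)"
        unfolding real_norm_def[symmetric]
      proof (rule Bochner_Integration.integral_norm_bound_integral)
        show "integrable half_line (\<lambda>x. (q (exp (- x)) - p (exp (- x))) * (exp (- x) * \<phi> x))"
          by (rule int_mult) (intro continuous_intros q cp)
        show "integrable half_line (\<lambda>x. e / (A + 1) * norm (exp (- x) * \<phi> x))"
          by (intro integrable_mult_right integrable_norm int)
        show "norm ((q (exp (- x)) - p (exp (- x))) * (exp (- x) * \<phi> x))
            \<le> e / (A + 1) * norm (exp (- x) * \<phi> x)" if "x \<in> space half_line" for x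
          unfolding norm_mult[of "q _ - p _"]
          using that p(2)[of "exp (- x)"] by (intro mult_right_mono) (auto simp: space_restrict_space)
      qed
      also have "\<dots> = e / (A + 1) * A" by (simp add: A_def)
      also have "\<dots> \<le> e" using A \<open>e > 0\<close> by (simp add: field_simps)
      finally show ?thesis by simp
    qed
    hence "\<bar>\<integral>x. q (exp (- x)) * (exp (- x) * \<phi> x) \<partial>half_line\<bar> \<le> 0"
      by (rule field_le_epsilon)
    thus ?thesis by simp
  qed
  have "isCont \<phi> x0"
    using cont \<open>x0 > 0\<close> by (simp add: continuous_on_eq_continuous_at)
  hence "((\<lambda>x. \<phi> x0 * \<phi> x) \<longlongrightarrow> \<phi> x0 * \<phi> x0) (nhds x0)"
    by (intro tendsto_mult_left) (simp add: isCont_def tendsto_at_iff_tendsto_nhds)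
  \<comment> \<open>Multiplying by the value \<open>\<phi> x0\<close> treats both signs at once; the
    bump \<open>q\<close> carries the same factor.\<close>
  moreover have "\<phi> x0 * \<phi> x0 > 0" using nz by (metis not_real_square_gt_zero)
  ultimately have "\<forall>\<^sub>F x in nhds x0. \<phi> x0 * \<phi> x > 0" by (rule order_tendstoD(1))
  then obtain d where d: "d > 0" "\<And>x. \<bar>x - x0\<bar> < d \<Longrightarrow> \<phi> x0 * \<phi> x > 0"
    by (auto simp: eventually_nhds_metric dist_real_def)
  \<comment> \<open>In the variable \<open>u = exp (- x)\<close> the quadratic is positive exactly
    between the images of \<open>x0 + d\<close> and \<open>x0 - d\<close>. If \<open>d > x0\<close>,
    the bump merely reaches past \<open>u = 1\<close>.\<close>
  define q where "q u = \<phi> x0 * max 0 ((u - exp (- (x0 + d))) * (exp (- (x0 - d)) - u))" for u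
  define F where "F x = q (exp (- x)) * (exp (- x) * \<phi> x)" for x
  have q: "continuous_on {0..1} q" unfolding q_def by (intro continuous_intros)
  have inside: "(exp (- x) - exp (- (x0 + d))) * (exp (- (x0 - d)) - exp (- x)) > 0 \<longleftrightarrow> \<bar>x - x0\<bar> < d" for x
    using \<open>d > 0\<close> by (auto simp: zero_less_mult_iff)
  have F_pos: "F x > 0" if "\<bar>x - x0\<bar> < d" for x
  proof -
    have "F x = (exp (- x) - exp (- (x0 + d))) * (exp (- (x0 - d)) - exp (- x)) * exp (- x) * (\<phi> x0 * \<phi> x)"
      using that inside[of x] by (simp add: F_def q_def max_def mult_ac)
    also have "\<dots> > 0"
      by (rule mult_pos_pos[OF mult_pos_pos[OF iffD2[OF inside that] exp_gt_zero] d(2)[OF that]])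
    finally show ?thesis .
  qed
  have F_nonneg: "F x \<ge> 0" for x
    using F_pos[of x] inside[of x] by (cases "\<bar>x - x0\<bar> < d") (auto simp: F_def q_def max_def)
  have "AE x in half_line. F x = 0"
    using cont_zero[OF q] int_mult[OF q] F_nonneg
    unfolding F_def[abs_def, symmetric] F_def[symmetric]
    by (subst integral_nonneg_eq_0_iff_AE[symmetric]) auto
  hence "AE x in lborel. x \<in> {0<..} \<longrightarrow> F x = 0"
    by (subst (asm) AE_restrict_space_iff) auto
  \<comment> \<open>The right half of the neighbourhood lies in the half line whatever the size of
    \<open>d\<close>.\<close>
  hence "AE x in lborel. x \<notin> {x0<..<x0 + d}"
  proof eventually_elim
    case (elim x)
    have "F x > 0" if "x \<in> {x0<..<x0 + d}" by (rule F_pos) (use that in auto)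
    thus ?case using elim \<open>x0 > 0\<close> by fastforce
  qed
  hence "{x0<..<x0 + d} \<in> null_sets lborel" by (subst AE_iff_null_sets) auto
  thus False using \<open>d > 0\<close> by (auto simp: null_sets_def)
qed

lemma laplace_transform_unique:
  fixes \<phi> :: "real \<Rightarrow> complex"
  assumes cont: "continuous_on {0<..} \<phi>"
    and int: "integrable half_line (\<lambda>x. of_real (exp (- x)) * \<phi> x)"
    and zero: "\<And>n::nat. (\<integral>x. of_real (exp (- (real (Suc n) * x))) * \<phi> x \<partial>half_line) = 0"
    and "x0 > 0"
  shows "\<phi> x0 = 0"
proof -
  have int': "integrable half_line (\<lambda>x. of_real (exp (- (real (Suc n) * x))) * \<phi> x)" for n :: nat
  proof (rule Bochner_Integration.integrable_bound[OF int])
    show "(\<lambda>x. of_real (exp (- (real (Suc n) * x))) * \<phi> x) \<in> borel_measurable half_line"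
      by (intro measurable_half_lineI continuous_intros cont)
    show "AE x in half_line. norm (of_real (exp (- (real (Suc n) * x))) * \<phi> x)
            \<le> norm (of_real (exp (- x)) * \<phi> x)"
      by (rule AE_half_lineI) (auto simp: norm_mult intro!: mult_right_mono)
  qed
  have "Re (\<phi> x0) = 0"
  proof (rule laplace_transform_unique_real[OF _ _ _ \<open>x0 > 0\<close>])
    show "continuous_on {0<..} (\<lambda>x. Re (\<phi> x))" by (intro continuous_intros cont)
    show "integrable half_line (\<lambda>x. exp (- x) * Re (\<phi> x))"
      using integrable_Re[OF int] by simp
    show "(\<integral>x. exp (- (real (Suc n) * x)) * Re (\<phi> x) \<partial>half_line) = 0" for n :: nat
      using integral_Re[OF int'[of n]] zero[of n] by (simp del: of_nat_Suc)
  qed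
  moreover have "Im (\<phi> x0) = 0"
  proof (rule laplace_transform_unique_real[OF _ _ _ \<open>x0 > 0\<close>])
    show "continuous_on {0<..} (\<lambda>x. Im (\<phi> x))" by (intro continuous_intros cont)
    show "integrable half_line (\<lambda>x. exp (- x) * Im (\<phi> x))"
      using integrable_Im[OF int] by simp
    show "(\<integral>x. exp (- (real (Suc n) * x)) * Im (\<phi> x) \<partial>half_line) = 0" for n :: nat
      using integral_Im[OF int'[of n]] zero[of n] by (simp del: of_nat_Suc)
  qed
  ultimately show ?thesis by (simp add: complex_eq_iff)
qed

lemma clifford_transform_involution:
  assumes \<nu>: "Re \<nu> > -1" and g: "rapidly_decreasing g"
    and Tg: "rapidly_decreasing (clifford_transform \<nu> g)" and "x0 > 0"
  shows "clifford_transform \<nu> (clifford_transform \<nu> g) x0 = g x0"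
proof -
  define h where "h = clifford_transform \<nu> (clifford_transform \<nu> g)"
  define e where "e s x = complex_of_real (exp (- (s * x)))" for s x
  \<comment> \<open>Including the weight turns the weighted Laplace transforms into an ordinary one;
    it does not vanish at \<open>x0\<close> and can be cancelled at the end.\<close>
  define \<phi> where "\<phi> x = of_real x powr \<nu> * (h x - g x)" for x
  have cont_h: "continuous_on {0<..} h"
    unfolding h_def by (rule continuous_on_subset[OF continuous_on_clifford_transform[OF \<nu> Tg]]) auto
  have cont_g: "continuous_on {0<..} g" using g by (simp add: rapidly_decreasing_def)
  have e: "rapidly_decreasing (e s)" if "s > 0" for s
    unfolding e_def by (rule rapidly_decreasing_exp[OF that])
  have Te: "clifford_transform \<nu> (e s) y = of_real s powr (- \<nu> - 1) * e (1 / s) y"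
    if "s > 0" "y > 0" for s y
    using clifford_transform_exp[OF \<nu>, of s y] that by (simp add: e_def[abs_def])
  \<comment> \<open>For the double transform \<open>h\<close> only linear growth is known at this
    point, so the decay has to come from the exponential.\<close>
  have eh: "rapidly_decreasing (\<lambda>x. h x * e s x)" if s: "s > 0" for s
  proof -
    obtain K where K: "\<And>y. y \<ge> 0 \<Longrightarrow> norm (h y) \<le> K * (1 + y)"
      by (rule clifford_transform_linear_bound[OF \<nu> Tg, folded h_def]) (rule that)
    show ?thesis by (rule rapidly_decreasing_mult[OF e[OF s] cont_h K]) auto
  qed
  have eg: "rapidly_decreasing (\<lambda>x. e s x * g x)" if s: "s > 0" for s
  proof (rule rapidly_decreasing_mult[OF g])
    show "continuous_on {0<..} (e s)" unfolding e_def by (intro continuous_intros)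
    fix x :: real assume "x > 0"
    hence "norm (e s x) \<le> 1" using s by (simp add: e_def)
    thus "norm (e s x) \<le> 1 * (1 + x)" using \<open>x > 0\<close> by simp
  qed
  have int_h: "integrable half_line (\<lambda>x. of_real x powr \<nu> * (e s x * h x))"
    and int_g: "integrable half_line (\<lambda>x. of_real x powr \<nu> * (e s x * g x))" if "s > 0" for s
    using integrable_powr_rapidly_decreasing[OF \<nu> eh[OF that]]
      integrable_powr_rapidly_decreasing[OF \<nu> eg[OF that]] by (simp_all add: mult_ac)
  have swap: "(\<integral>x. of_real x powr \<nu> * (e s x * clifford_transform \<nu> k x) \<partial>half_line)
       = of_real s powr (- \<nu> - 1) * (\<integral>x. of_real x powr \<nu> * (e (1 / s) x * k x) \<partial>half_line)"
    if s: "s > 0" and k: "rapidly_decreasing k" for s k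
  proof -
    have "(\<integral>x. of_real x powr \<nu> * (e s x * clifford_transform \<nu> k x) \<partial>half_line)
        = (\<integral>x. of_real x powr \<nu> * (k x * clifford_transform \<nu> (e s) x) \<partial>half_line)"
      by (rule clifford_transform_symmetric[OF \<nu> e[OF s] k])
    also have "\<dots> = (\<integral>x. of_real s powr (- \<nu> - 1) * (of_real x powr \<nu> * (e (1 / s) x * k x)) \<partial>half_line)"
      by (rule integral_half_line_cong) (simp add: Te s mult_ac)
    also have "\<dots> = of_real s powr (- \<nu> - 1) * (\<integral>x. of_real x powr \<nu> * (e (1 / s) x * k x) \<partial>half_line)"
      by (rule integral_mult_right_zero)
    finally show ?thesis .
  qed
  \<comment> \<open>Applying \<open>swap\<close> to \<open>clifford_transform \<nu> g\<close> at
    \<open>s\<close> and then to \<open>g\<close> at \<open>1 / s\<close> restores the exponential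
    \<open>e s\<close>; the two prefactors multiply to 1.\<close>
  have laplace: "(\<integral>x. of_real x powr \<nu> * (e s x * h x) \<partial>half_line)
      = (\<integral>x. of_real x powr \<nu> * (e s x * g x) \<partial>half_line)" if s: "s > 0" for s
  proof -
    have "complex_of_real s powr (- \<nu> - 1) * of_real (1 / s) powr (- \<nu> - 1)
        = of_real (s * (1 / s)) powr (- \<nu> - 1)"
      using s by (subst of_real_mult, subst powr_times_real) auto
    also have "\<dots> = 1" using s by simp
    finally have "complex_of_real s powr (- \<nu> - 1) * of_real (1 / s) powr (- \<nu> - 1) = 1" .
    thus ?thesis
      using swap[OF s Tg] swap[of "1 / s", OF _ g] s by (simp add: h_def flip: mult.assoc)
  qed
  have "\<phi> x0 = 0"
  proof (rule laplace_transform_unique[OF _ _ _ \<open>x0 > 0\<close>])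
    show "continuous_on {0<..} \<phi>"
      unfolding \<phi>_def by (intro continuous_on_mult continuous_on_of_real_powr continuous_intros cont_h cont_g)
    have eq: "e s x * \<phi> x = of_real x powr \<nu> * (e s x * h x) - of_real x powr \<nu> * (e s x * g x)" for s x
      by (simp add: \<phi>_def algebra_simps)
    show "integrable half_line (\<lambda>x. of_real (exp (- x)) * \<phi> x)"
      using Bochner_Integration.integrable_diff[OF int_h[of 1] int_g[of 1]] eq[of 1] by (simp add: e_def)
    fix n :: nat
    have "(\<integral>x. e (real (Suc n)) x * \<phi> x \<partial>half_line) = 0"
      unfolding eq
      by (subst Bochner_Integration.integral_diff[OF int_h int_g]) (simp_all add: laplace)
    thus "(\<integral>x. of_real (exp (- (real (Suc n) * x))) * \<phi> x \<partial>half_line) = 0"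
      by (simp add: e_def)
  qed
  thus ?thesis using \<open>x0 > 0\<close> by (simp add: \<phi>_def h_def)
qed

subsection \<open>Decay of the transform\<close>

text \<open>The whole sequence of derivatives is the datum, so the Bessel operator can be iterated
  by explicit formulas without computing iterated derivatives of products.\<close>

definition schwartz_derivs :: "(nat \<Rightarrow> real \<Rightarrow> complex) \<Rightarrow> bool" where
  "schwartz_derivs D \<longleftrightarrow>
     (\<forall>n. rapidly_decreasing (D n)) \<and>
     (\<forall>n. \<forall>x>0. (D n has_vector_derivative D (Suc n) x) (at x))"

text \<open>Disposes of the boundary terms in the integration by parts: boundedness of
  \<open>h\<close> suffices at 0 because \<open>Re b > 0\<close>, and decay of an order above
  \<open>Re b\<close> suffices at infinity.\<close>

lemma rapidly_decreasing_tendsto_0: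
  assumes h: "rapidly_decreasing h" and b: "Re b > 0"
  shows "((\<lambda>x. of_real x powr b * h x) \<longlongrightarrow> 0) (at_right 0)"
    and "((\<lambda>x. of_real x powr b * h x) \<longlongrightarrow> 0) at_top"
proof -
  obtain B where B: "B > 0" "\<And>x. x > 0 \<Longrightarrow> x ^ 0 * norm (h x) \<le> B"
    using rapidly_decreasing_bound[OF h] by blast
  have "((\<lambda>x. x powr Re b * B) \<longlongrightarrow> 0 powr Re b * B) (at_right 0)"
    using b by (intro tendsto_intros) (auto intro: eventually_mono[OF eventually_at_right_less])
  hence lim: "((\<lambda>x. x powr Re b * B) \<longlongrightarrow> 0) (at_right 0)" by simp
  show "((\<lambda>x. of_real x powr b * h x) \<longlongrightarrow> 0) (at_right 0)"
  proof (rule Lim_null_comparison[OF _ lim])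
    show "\<forall>\<^sub>F x in at_right 0. norm (of_real x powr b * h x) \<le> x powr Re b * B"
      using eventually_at_right_less[of 0]
    proof eventually_elim
      case (elim x)
      thus ?case using B(2)[of x] by (auto simp: norm_mult norm_powr_real_powr intro!: mult_left_mono)
    qed
  qed
  obtain n :: nat where n: "real n > Re b" using reals_Archimedean2 by blast
  obtain B' where B': "B' > 0" "\<And>x. x > 0 \<Longrightarrow> x ^ n * norm (h x) \<le> B'"
    using rapidly_decreasing_bound[OF h] by blast
  have "((\<lambda>x. x powr (Re b - real n)) \<longlongrightarrow> 0) at_top"
    using n by (intro tendsto_neg_powr filterlim_ident) auto
  hence lim: "((\<lambda>x. x powr (Re b - real n) * B') \<longlongrightarrow> 0) at_top"
    by (rule tendsto_mult_left_zero)
  show "((\<lambda>x. of_real x powr b * h x) \<longlongrightarrow> 0) at_top"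
  proof (rule Lim_null_comparison[OF _ lim])
    show "\<forall>\<^sub>F x in at_top. norm (of_real x powr b * h x) \<le> x powr (Re b - real n) * B'"
      using eventually_gt_at_top[of 0]
    proof eventually_elim
      case (elim x)
      have "norm (of_real x powr b * h x) = x powr (Re b - real n) * (x ^ n * norm (h x))"
        using elim by (simp add: norm_mult norm_powr_real_powr powr_diff powr_realpow)
      also have "\<dots> \<le> x powr (Re b - real n) * B'"
        using B'(2)[OF elim] by (intro mult_left_mono) auto
      finally show ?case .
    qed
  qed
qed

text \<open>
  Integration by parts: \<open>x (d/dx)\<^sup>2 + (\<nu> + 1) d/dx\<close> is symmetric for the weight
  \<open>x powr \<nu>\<close> and multiplies the kernel by \<open>- y\<close>.
\<close>

lemma clifford_transform_bessel_operator:
  assumes \<nu>: "Re \<nu> > -1" and D: "schwartz_derivs D" and y: "y > 0"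
  shows "clifford_transform \<nu> (\<lambda>x. of_real x * D 2 x + (\<nu> + 1) * D 1 x) y
           = - of_real y * clifford_transform \<nu> (D 0) y"
proof -
  define C where "C \<mu> x = bessel_clifford \<mu> (of_real (x * y))" for \<mu> x
  have rD: "rapidly_decreasing (D n)" for n using D by (simp add: schwartz_derivs_def)
  have dD: "(D n has_vector_derivative D (Suc n) x) (at x)" if "x > 0" for n x
    using D that by (simp add: schwartz_derivs_def)
  have dC: "(C \<mu> has_vector_derivative - of_real y * C (\<mu> + 1) x) (at x)" if "Re \<mu> > -1" for \<mu> x
    unfolding C_def by (rule bessel_clifford_vector_derivative[OF that])
  \<comment> \<open>With \<open>g = D 0\<close> and the kernel \<open>C = C \<nu>\<close>, this is
    \<open>x powr (\<nu> + 1) * (C' g - C g')\<close>, the weighted Wronskian of Lagrange's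
    identity. Its derivative \<open>p\<close> is \<open>x powr \<nu>\<close> times
    \<open>g * L C - C * L g\<close>, where \<open>L\<close> is the Bessel operator and
    \<open>L C = - y C\<close>.\<close>
  define P where "P x = of_real x powr (\<nu> + 1)
      * (- of_real y * (C (\<nu> + 1) x * D 0 x) + (- 1) * (C \<nu> x * D 1 x))" for x
  define p where "p x = of_real x powr \<nu>
      * (C \<nu> x * (- (of_real x * D 2 x + (\<nu> + 1) * D 1 x) + (- of_real y) * D 0 x))" for x
  have r1: "rapidly_decreasing (\<lambda>x. - of_real y * (C (\<nu> + 1) x * D 0 x) + (- 1) * (C \<nu> x * D 1 x))"
    unfolding C_def using \<nu> y
    by (intro rapidly_decreasing_add rapidly_decreasing_cmult
          rapidly_decreasing_bessel_clifford_mult rD) auto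
  have rE: "rapidly_decreasing (\<lambda>x. of_real x * D 2 x + (\<nu> + 1) * D 1 x)"
    using rapidly_decreasing_add[OF rapidly_decreasing_mult_linear[OF rD, of 0]
        rapidly_decreasing_cmult[OF rD]] by simp
  have r2: "rapidly_decreasing (\<lambda>x. - (of_real x * D 2 x + (\<nu> + 1) * D 1 x) + (- of_real y) * D 0 x)"
    using rapidly_decreasing_add[OF rapidly_decreasing_cmult[OF rE, of "-1"]
        rapidly_decreasing_cmult[OF rD, of "- of_real y" 0]] by simp
  have P': "(P has_vector_derivative p x) (at x)" if x: "x > 0" for x
  proof -
    have pw: "((\<lambda>x. complex_of_real x powr (\<nu> + 1)) has_vector_derivative
            (\<nu> + 1) * of_real x powr \<nu>) (at x)"
      using x by (auto intro!: derivative_eq_intros has_vector_derivative_real_field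
          simp: complex_nonpos_Reals_iff)
    have "(P has_vector_derivative
        of_real x powr (\<nu> + 1) *
          (- of_real y * (C (\<nu> + 1) x * D (Suc 0) x + (- of_real y * C (\<nu> + 1 + 1) x) * D 0 x)
           + (- 1) * (C \<nu> x * D (Suc 1) x + (- of_real y * C (\<nu> + 1) x) * D 1 x))
        + (\<nu> + 1) * of_real x powr \<nu> * (- of_real y * (C (\<nu> + 1) x * D 0 x) + (- 1) * (C \<nu> x * D 1 x)))
        (at x)"
      unfolding P_def using \<nu>
      by (intro has_vector_derivative_mult has_vector_derivative_add
            has_vector_derivative_mult_right pw dC dD x) auto
    also have "of_real x powr (\<nu> + 1) = of_real x powr \<nu> * complex_of_real x"
      using x by (simp add: powr_add)
    also have "of_real x powr \<nu> * of_real x *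
          (- of_real y * (C (\<nu> + 1) x * D (Suc 0) x + (- of_real y * C (\<nu> + 1 + 1) x) * D 0 x)
           + (- 1) * (C \<nu> x * D (Suc 1) x + (- of_real y * C (\<nu> + 1) x) * D 1 x))
        + (\<nu> + 1) * of_real x powr \<nu> * (- of_real y * (C (\<nu> + 1) x * D 0 x) + (- 1) * (C \<nu> x * D 1 x))
        = p x"
    proof -
      \<comment> \<open>The recurrence eliminates the order \<open>\<nu> + 2\<close> produced by
        differentiating the kernel twice.\<close>
      have "C \<nu> x = (\<nu> + 1) * C (\<nu> + 1) x - of_real (x * y) * C (\<nu> + 1 + 1) x"
        using bessel_clifford_recurrence[OF \<nu>, of "of_real (x * y)"] by (simp add: C_def add.assoc)
      hence "of_real x * (of_real y * C (\<nu> + 1 + 1) x) = (\<nu> + 1) * C (\<nu> + 1) x - C \<nu> x"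
        by (simp add: algebra_simps)
      thus ?thesis unfolding p_def numeral_2_eq_2 One_nat_def by algebra
    qed
    finally show ?thesis .
  qed
  have int: "integrable half_line p"
    unfolding p_def C_def using y
    by (intro integrable_powr_rapidly_decreasing[OF \<nu>] rapidly_decreasing_bessel_clifford_mult \<nu> r2) auto
  have ein: "einterval (ereal 0) \<infinity> = {0<..}" by (auto simp: einterval_def)
  have "(LBINT x=ereal 0..\<infinity>. p x) = 0 - 0"
  proof (rule interval_integral_FTC_integrable)
    show "(P has_vector_derivative p x) (at x)" if "ereal 0 < ereal x" for x
      using P' that by simp
    show "isCont p x" if "ereal 0 < ereal x" for x
    proof -
      have "continuous_on {0<..} p"
        unfolding p_def C_def using r2 
        by (intro continuous_on_mult continuous_on_of_real_powr continuous_on_bessel_clifford_mult \<nu>)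
           (auto simp: rapidly_decreasing_def)
      thus ?thesis using that by (simp add: continuous_on_eq_continuous_at)
    qed
    show "set_integrable lborel (einterval (ereal 0) \<infinity>) p"
      using int unfolding ein integrable_half_line_iff .
    show "((P \<circ> real_of_ereal) \<longlongrightarrow> 0) (at_right (ereal 0))" "((P \<circ> real_of_ereal) \<longlongrightarrow> 0) (at_left \<infinity>)"
      unfolding ereal_tendsto_simps unfolding P_def
      using rapidly_decreasing_tendsto_0[OF r1, of "\<nu> + 1"] \<nu> by simp_all
  qed simp
  hence "integral\<^sup>L half_line p = 0"
    unfolding interval_lebesgue_integral_def ein integral_half_line_eq by simp
  also have "integral\<^sup>L half_line p =
      - clifford_transform \<nu> (\<lambda>x. of_real x * D 2 x + (\<nu> + 1) * D 1 x) y
      - of_real y * clifford_transform \<nu> (D 0) y"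
  proof -
    have "p = (\<lambda>x. - (of_real x powr \<nu> * (C \<nu> x * (of_real x * D 2 x + (\<nu> + 1) * D 1 x)))
                  - of_real y * (of_real x powr \<nu> * (C \<nu> x * D 0 x)))"
      by (simp add: p_def fun_eq_iff algebra_simps)
    thus ?thesis
      using integrable_clifford_transform[OF \<nu> rE, of y] integrable_clifford_transform[OF \<nu> rD, of y 0] y
      by (simp add: clifford_transform_def C_def del: of_real_mult)
  qed
  finally show ?thesis by (metis eq_iff_diff_eq_0 minus_minus mult_minus_left)
qed

text \<open>By the Leibniz rule each differentiation of the factor \<open>x\<close> releases one
  more copy of \<open>D (n + 1)\<close>, whence the summand \<open>n\<close> in the coefficient. The
  entry \<open>n = 0\<close> is the operator itself.\<close>

lemma schwartz_derivs_bessel_operator: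
  assumes D: "schwartz_derivs D"
  shows "schwartz_derivs (\<lambda>n x. of_real x * D (n + 2) x + (of_nat n + \<nu> + 1) * D (n + 1) x)"
  unfolding schwartz_derivs_def
proof (intro conjI allI impI)
  have rD: "rapidly_decreasing (D n)" for n using D by (simp add: schwartz_derivs_def)
  show "rapidly_decreasing (\<lambda>x. of_real x * D (n + 2) x + (of_nat n + \<nu> + 1) * D (n + 1) x)" for n
    using rapidly_decreasing_add[OF rapidly_decreasing_mult_linear[OF rD, of 0]
        rapidly_decreasing_cmult[OF rD]] by simp
  fix n and x :: real assume x: "x > 0"
  have dD: "(D n has_vector_derivative D (Suc n) x) (at x)" for n
    using D x by (simp add: schwartz_derivs_def)
  have "((\<lambda>x. complex_of_real x) has_vector_derivative 1) (at x)"
    by (rule has_vector_derivative_real_field) (auto intro!: derivative_eq_intros)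
  hence "((\<lambda>x. of_real x * D (n + 2) x + (of_nat n + \<nu> + 1) * D (n + 1) x) has_vector_derivative
      (of_real x * D (Suc (n + 2)) x + 1 * D (n + 2) x) + (of_nat n + \<nu> + 1) * D (Suc (n + 1)) x) (at x)"
    by (intro has_vector_derivative_add has_vector_derivative_mult
          has_vector_derivative_mult_right dD)
  thus "((\<lambda>x. of_real x * D (n + 2) x + (of_nat n + \<nu> + 1) * D (n + 1) x) has_vector_derivative
      of_real x * D (Suc n + 2) x + (of_nat (Suc n) + \<nu> + 1) * D (Suc n + 1) x) (at x)"
    by (simp add: algebra_simps)
qed

text \<open>Each factor \<open>y\<close> is traded for one application of the Bessel operator, which
  changes \<open>D\<close>; the induction therefore runs over all \<open>D\<close>, and the linear
  bound is used only at the end.\<close>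

lemma clifford_transform_power_bound:
  assumes \<nu>: "Re \<nu> > -1"
  shows "schwartz_derivs D \<Longrightarrow>
    \<exists>K. \<forall>y>0. y ^ m * norm (clifford_transform \<nu> (D 0) y) \<le> K * (1 + y)"
proof (induction m arbitrary: D)
  case 0
  hence "rapidly_decreasing (D 0)" by (simp add: schwartz_derivs_def)
  then obtain K where K: "\<And>y. y \<ge> 0 \<Longrightarrow> norm (clifford_transform \<nu> (D 0) y) \<le> K * (1 + y)"
    by (rule clifford_transform_linear_bound[OF \<nu>]) (rule that)
  thus ?case by (intro exI[of _ K]) auto
next
  case (Suc m)
  from Suc.IH[OF schwartz_derivs_bessel_operator[OF Suc.prems, of \<nu>]] obtain K where
    K: "\<forall>y>0. y ^ m * norm (clifford_transform \<nu> (\<lambda>x. of_real x * D 2 x + (\<nu> + 1) * D 1 x) y)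
              \<le> K * (1 + y)" by (auto simp: numeral_2_eq_2)
  have "y ^ Suc m * norm (clifford_transform \<nu> (D 0) y) \<le> K * (1 + y)" if y: "y > 0" for y
    using K[rule_format, OF y] y
    unfolding clifford_transform_bessel_operator[OF \<nu> Suc.prems y]
    by (simp add: norm_mult mult_ac)
  thus ?case by blast
qed

text \<open>Adding the bounds for the powers \<open>m\<close> and \<open>Suc m\<close> produces the
  factor \<open>1 + y\<close> on the left, which cancels the linear growth on the right.\<close>

lemma rapidly_decreasing_clifford_transform:
  assumes \<nu>: "Re \<nu> > -1" and D: "schwartz_derivs D"
  shows "rapidly_decreasing (clifford_transform \<nu> (D 0))"
  unfolding rapidly_decreasing_def
proof (intro conjI allI)
  have r: "rapidly_decreasing (D 0)" using D by (simp add: schwartz_derivs_def)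
  show "continuous_on {0<..} (clifford_transform \<nu> (D 0))"
    by (rule continuous_on_subset[OF continuous_on_clifford_transform[OF \<nu> r]]) auto
  fix m
  let ?T = "\<lambda>y. norm (clifford_transform \<nu> (D 0) y)"
  obtain K where K: "\<forall>y>0. y ^ m * ?T y \<le> K * (1 + y)"
    using clifford_transform_power_bound[OF \<nu> D] by blast
  obtain L where L: "\<forall>y>0. y ^ Suc m * ?T y \<le> L * (1 + y)"
    using clifford_transform_power_bound[OF \<nu> D] by blast
  have "y ^ m * ?T y \<le> K + L" if y: "y > 0" for y
  proof -
    have "y ^ m * ?T y * (1 + y) = y ^ m * ?T y + y ^ Suc m * ?T y" by (simp add: algebra_simps)
    also have "\<dots> \<le> (K + L) * (1 + y)" using K L y by (simp add: distrib_right add_mono)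
    finally show ?thesis using y by (simp add: mult_le_cancel_right)
  qed
  thus "\<exists>B. \<forall>y>0. y ^ m * ?T y \<le> B" by blast
qed

lemma schwartz_derivs_deriv_half_line:
  assumes g: "g \<in> schwartz_half_line"
  shows "schwartz_derivs (\<lambda>n. deriv_half_line n g)"
proof -
  have deriv: "(deriv_half_line n g has_vector_derivative deriv_half_line (Suc n) g x) (at x)"
    if x: "x > 0" for n x
  proof -
    have "deriv_half_line n g differentiable (at x within {0..})"
      using g x by (simp add: schwartz_half_line_def smooth_half_line_def)
    hence "(deriv_half_line n g has_vector_derivative deriv_half_line (Suc n) g x) (at x within {0..})"
      by (simp add: vector_derivative_works deriv_half_line_def)
    moreover have "at x within {0..} = at x"
      using x by (intro at_within_interior) simp
    ultimately show ?thesis by simp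
  qed
  show ?thesis
    unfolding schwartz_derivs_def rapidly_decreasing_def
  proof (intro conjI allI impI)
    show "continuous_on {0<..} (deriv_half_line n g)" for n
      by (intro continuous_at_imp_continuous_on) (auto intro: has_vector_derivative_continuous deriv)
    show "\<exists>B. \<forall>x>0. x ^ m * norm (deriv_half_line n g x) \<le> B" for m n
    proof -
      have "bounded ((\<lambda>x. of_real (x ^ m) * deriv_half_line n g x) ` {0..})"
        using g by (simp add: schwartz_half_line_def)
      then obtain B where "\<forall>x\<in>{0..}. norm (of_real (x ^ m) * deriv_half_line n g x) \<le> B"
        by (auto simp: bounded_iff)
      thus ?thesis by (intro exI[of _ B]) (auto simp: norm_mult norm_power)
    qed
  qed (use deriv in auto)
qed

subsection \<open>The Hankel transform\<close>

text \<open>The function and the kernel each contribute \<open>x powr (1/2 + \<nu>/2)\<close>, and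
  division by \<open>x\<close> leaves \<open>x powr \<nu>\<close>. Asking for the form of
  \<open>f\<close> at \<open>x > 0\<close> only makes this applicable also to
  \<open>hankel \<nu> f\<close>, with the transform of \<open>g\<close> in place of
  \<open>g\<close>.\<close>

lemma hankel_eq_clifford_transform:
  assumes \<nu>: "Re \<nu> > -1"
    and f: "\<And>x. x > 0 \<Longrightarrow> f x = of_real x powr (1/2 + \<nu>/2) * g x" and y: "y > 0"
  shows "hankel \<nu> f y = of_real y powr (1/2 + \<nu>/2) * clifford_transform \<nu> g y"
proof -
  let ?w = "\<lambda>t::real. complex_of_real t powr (1/2 + \<nu>/2)"
  have "hankel \<nu> f y = (\<integral>x. f x * of_real (sqrt (x * y)) * bessel_J \<nu> (2 * sqrt (x * y)) / of_real x \<partial>half_line)"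
    using y by (simp add: hankel_def integral_half_line_eq)
  also have "\<dots> = (\<integral>x. ?w y * (of_real x powr \<nu> * (bessel_clifford \<nu> (of_real (x * y)) * g x)) \<partial>half_line)"
  proof (rule integral_half_line_cong)
    fix x :: real assume x: "x > 0"
    have root: "complex_of_real (sqrt t) * of_real t powr (\<nu>/2) = ?w t" if "t > 0" for t
      using that powr_of_real[of t "1/2"] by (simp add: powr_add powr_half_sqrt)
    have "of_real (sqrt (x * y)) * bessel_J \<nu> (2 * sqrt (x * y))
        = ?w (x * y) * bessel_clifford \<nu> (of_real (x * y))"
      using x y by (simp add: bessel_J_eq_bessel_clifford[OF \<nu>] mult.assoc flip: root del: of_real_mult)
    also have "?w (x * y) = ?w x * ?w y"
      using x y by (simp add: powr_times_real)
    finally have "f x * of_real (sqrt (x * y)) * bessel_J \<nu> (2 * sqrt (x * y)) / of_real x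
        = (?w x * ?w x / of_real x) * (?w y * (bessel_clifford \<nu> (of_real (x * y)) * g x))"
      by (simp add: f[OF x] mult_ac del: of_real_mult)
    also have "?w x * ?w x = of_real x powr (\<nu> + 1)"
      by (simp add: add.commute flip: powr_add)
    also have "\<dots> / of_real x = of_real x powr \<nu>"
      using x by (simp add: powr_add)
    finally show "f x * of_real (sqrt (x * y)) * bessel_J \<nu> (2 * sqrt (x * y)) / of_real x
        = ?w y * (of_real x powr \<nu> * (bessel_clifford \<nu> (of_real (x * y)) * g x))"
      by (simp add: mult_ac del: of_real_mult)
  qed
  also have "\<dots> = ?w y * clifford_transform \<nu> g y"
    unfolding clifford_transform_def by (rule integral_mult_right_zero)
  finally show ?thesis .
qed

theorem theorem3p2:
  fixes \<nu> :: complex and f :: "real \<Rightarrow> complex"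
  assumes "Re \<nu> > -1"
    and "f \<in> hankel_space \<nu>"
  shows "\<forall>y\<ge>0. hankel \<nu> (hankel \<nu> f) y = f y"
proof (intro allI impI)
  fix y :: real assume "y \<ge> 0"
  obtain g where g: "g \<in> schwartz_half_line"
    and f: "\<And>x. x \<ge> 0 \<Longrightarrow> f x = of_real x powr (1/2 + \<nu>/2) * g x"
    using assms(2) by (auto simp: hankel_space_def)
  have D: "schwartz_derivs (\<lambda>n. deriv_half_line n g)"
    by (rule schwartz_derivs_deriv_half_line[OF g])
  have D0: "deriv_half_line 0 g = g" by (simp add: deriv_half_line_def)
  have rg: "rapidly_decreasing g" using D unfolding schwartz_derivs_def by (metis D0)
  have rTg: "rapidly_decreasing (clifford_transform \<nu> g)"
    using rapidly_decreasing_clifford_transform[OF assms(1) D] by (simp add: D0)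
  show "hankel \<nu> (hankel \<nu> f) y = f y"
  proof (cases "y = 0")
    case True
    \<comment> \<open>Both sides are 0: the transform by its default value, and \<open>f\<close>
      because \<open>0 powr z = 0\<close>.\<close>
    thus ?thesis by (simp add: hankel_def f)
  next
    case False
    with \<open>y \<ge> 0\<close> have y: "y > 0" by simp
    have "hankel \<nu> f x = of_real x powr (1/2 + \<nu>/2) * clifford_transform \<nu> g x" if "x > 0" for x
      by (rule hankel_eq_clifford_transform[OF assms(1) f that]) simp
    hence "hankel \<nu> (hankel \<nu> f) y
        = of_real y powr (1/2 + \<nu>/2) * clifford_transform \<nu> (clifford_transform \<nu> g) y"
      by (rule hankel_eq_clifford_transform[OF assms(1) _ y])
    also have "\<dots> = f y"
      using y by (simp add: clifford_transform_involution[OF assms(1) rg rTg] f)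
    finally show ?thesis .
  qed
qed

end
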